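(* Let $p\in\mathbb C[z,w]$ be a non-zero homogeneous polynomial, with associated measure $\mu$, orthonormal polynomials $\varphi_n$, Verblunsky coefficients $(\alpha_n)_{n\ge0}$, and numbers $F_k(n)=\langle\varphi_n^*,\zeta^k\varphi_n\rangle_\mu$. For every $k\ge1$ and $m\ge0$, $$F_k(2m)=(\mathbf C^{k-1}\mathbf L)_{2m,2m},\qquad F_k(2m+1)=(\mathbf M\mathbf C^{k-1})_{2m+1,2m+1}.$$ Consequently, for every $k\geq 1$, $$\Sigma_k([p])=\sum_{m\ge0}|(\mathbf C^{k-1}\mathbf L)_{2m,2m}|^2+\sum_{m\ge0}|(\mathbf M\mathbf C^{k-1})_{2m+1,2m+1}|^2 .$$ For fixed $k\ge1$, apart from the finite left boundary (i.e. for all $n\ge k-1$), $F_k(n)$ depends only on $\alpha_{n-k+1},\ldots,\alpha_{n+k-1}$. Moreover, $(F_k(n))_{n\ge0}\in\ell^2$.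
   Context: $H^2(\mathbb D^2)$ is the Hardy space of the bidisc; inner products are linear in the first variable; $m$ denotes normalized Haar measure on $\mathbb T$ when used as a measure; $[p]$ is the closure of $p\,\mathbb C[z,w]$ in $H^2(\mathbb D^2)$. For $p\ne0$ homogeneous put $q(\zeta)=p(\zeta,1)$ and $d\mu=\frac{|q|^2}{\|q\|_2^2}dm$ on $\mathbb T$ ($\|q\|_2$ the $L^2(\mathbb T,m)$ norm). Let $(\varphi_n)_{n\ge0}$ be the orthonormal polynomials of $\mu$ with positive leading coefficients, $\varphi_n^*(\zeta)=\zeta^n\overline{\varphi_n(1/\overline\zeta)}$, and define the Verblunsky coefficients $\alpha_n\in\mathbb D$ by $\rho_n\varphi_{n+1}(\zeta)=\zeta\varphi_n(\zeta)-\overline{\alpha_n}\varphi_n^*(\zeta)$, $\rho_n=(1-|\alpha_n|^2)^{1/2}$. Put $$e_n(z,w)=\frac{p(z,w)}{\|p\|}w^n\varphi_n^*(z/w),\qquad f_n(z,w)=\frac{p(z,w)}{\|p\|}w^n\varphi_n(z/w)\qquad(n\ge0),$$ which are orthonormal bases of $[p]\ominus z[p]$ and $[p]\ominus w[p]$ respectively, and for $k\ge0$ define $$\Sigma_k([p])=\sum_{j,n\ge0}|\langle w^ke_j,z^kf_n\rangle|^2 .$$ With $$\Theta(\alpha)=\begin{pmatrix}\alpha&\rho\\ \rho&-\overline\alpha\end{pmatrix},\quad \rho=(1-|\alpha|^2)^{1/2},$$ the semi-infinite matrices (rows and columns indexed from $0$) are $$\mathbf L=\Theta(\alpha_0)\oplus\Theta(\alpha_2)\oplus\Theta(\alpha_4)\oplus\cdots,\quad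 \mathbf M=1\oplus\Theta(\alpha_1)\oplus\Theta(\alpha_3)\oplus\cdots,\quad \mathbf C=\mathbf L\mathbf M,$$ where $1$ is a $1\times1$ block. *)

theory Defs
  imports "HOL-Analysis.Analysis" "HOL-Computational_Algebra.Polynomial"
begin

section \<open>Polynomials in two variables and the Hardy space of the bidisc\<close>

text \<open>
  An element of \<open>\<complex>[z,w]\<close> is a polynomial in \<open>w\<close> whose coefficients are polynomials in \<open>z\<close>:
  the coefficient of \<open>z\<^sup>i w\<^sup>j\<close> in \<open>P :: complex poly poly\<close> is \<open>coeff (coeff P j) i\<close>.
\<close>

definition eval2 :: "complex poly poly \<Rightarrow> complex \<Rightarrow> complex \<Rightarrow> complex" where
  "eval2 P z w = poly (poly P [:w:]) z"

definition homogeneous :: "complex poly poly \<Rightarrow> bool" where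
  "homogeneous P \<longleftrightarrow> (\<exists>d. \<forall>i j. coeff (coeff P j) i \<noteq> 0 \<longrightarrow> i + j = d)"

definition zpow :: "nat \<Rightarrow> complex poly poly" where
  "zpow k = [:monom 1 k:]"

definition wpow :: "nat \<Rightarrow> complex poly poly" where
  "wpow k = monom 1 k"

text \<open>
  \<open>w\<^sup>n f(z/w)\<close> for \<open>degree f \<le> n\<close>, see lemma \<open>eval2_homogenize\<close>.
\<close>
definition homogenize :: "nat \<Rightarrow> complex poly \<Rightarrow> complex poly poly" where
  "homogenize n f = (\<Sum>i\<le>n. monom (monom (coeff f i) i) (n - i))"

lemma eval2_homogenize:
  assumes "degree f \<le> n" "w \<noteq> 0"
  shows "eval2 (homogenize n f) z w = w ^ n * poly f (z / w)"
proof -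
  have "eval2 (homogenize n f) z w = (\<Sum>i\<le>n. coeff f i * z ^ i * w ^ (n - i))"
    by (simp add: eval2_def homogenize_def poly_sum poly_monom)
  also have "\<dots> = (\<Sum>i\<le>n. w ^ n * (coeff f i * (z / w) ^ i))"
  proof (rule sum.cong)
    fix i assume "i \<in> {..n}"
    then have "w ^ n = w ^ (n - i) * w ^ i"
      by (simp flip: power_add)
    then show "coeff f i * z ^ i * w ^ (n - i) = w ^ n * (coeff f i * (z / w) ^ i)"
      using assms(2) by (simp add: power_divide)
  qed simp
  also have "\<dots> = w ^ n * (\<Sum>i\<le>n. coeff f i * (z / w) ^ i)"
    by (simp add: sum_distrib_left)
  also have "(\<Sum>i\<le>n. coeff f i * (z / w) ^ i) = poly f (z / w)"
    unfolding poly_altdef using assms(1)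
    by (intro sum.mono_neutral_right) (auto simp: coeff_eq_0)
  finally show ?thesis .
qed

text \<open>
  A function in \<open>H\<^sup>2\<close> of the bidisc is identified with its square-summable family of Taylor
  coefficients; the inner product is the one of \<open>\<ell>\<^sup>2\<close>.
\<close>
definition taylor :: "complex poly poly \<Rightarrow> nat \<times> nat \<Rightarrow> complex" where
  "taylor P = (\<lambda>(i, j). coeff (coeff P j) i)"

definition hardy_inner :: "(nat \<times> nat \<Rightarrow> complex) \<Rightarrow> (nat \<times> nat \<Rightarrow> complex) \<Rightarrow> complex" where
  "hardy_inner a b = (\<Sum>\<^sub>\<infinity>x. a x * cnj (b x))"

definition hardy_norm :: "(nat \<times> nat \<Rightarrow> complex) \<Rightarrow> real" where
  "hardy_norm a = sqrt (\<Sum>\<^sub>\<infinity>x. (cmod (a x))\<^sup>2)"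


section \<open>Orthonormal polynomials on the unit circle\<close>

text \<open>Normalized Haar measure of the unit circle, as a Borel measure on the plane.\<close>
definition circle_measure :: "complex measure" where
  "circle_measure = distr (uniform_measure lborel {0..<2 * pi}) borel cis"

definition L2_inner :: "complex measure \<Rightarrow> (complex \<Rightarrow> complex) \<Rightarrow> (complex \<Rightarrow> complex) \<Rightarrow> complex" where
  "L2_inner \<mu> f g = (\<integral>\<zeta>. f \<zeta> * cnj (g \<zeta>) \<partial>\<mu>)"

definition is_orthonormal_polys :: "complex measure \<Rightarrow> (nat \<Rightarrow> complex poly) \<Rightarrow> bool" where
  "is_orthonormal_polys \<mu> \<phi> \<longleftrightarrow>
     (\<forall>n. degree (\<phi> n) = n \<and> (\<exists>\<kappa>>0. lead_coeff (\<phi> n) = complex_of_real \<kappa>)) \<and>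
     (\<forall>m n. L2_inner \<mu> (poly (\<phi> m)) (poly (\<phi> n)) = (if m = n then 1 else 0))"

definition orthonormal_polys :: "complex measure \<Rightarrow> nat \<Rightarrow> complex poly" where
  "orthonormal_polys \<mu> = (THE \<phi>. is_orthonormal_polys \<mu> \<phi>)"

text \<open>
  \<open>\<zeta>\<^sup>n cnj (f (1 / cnj \<zeta>))\<close> as a polynomial, where \<open>n\<close> is the degree of \<open>f\<close>;
  see lemma \<open>poly_reversed\<close>.
\<close>
definition reversed :: "complex poly \<Rightarrow> complex poly" where
  "reversed f = map_poly cnj (reflect_poly f)"

lemma poly_reversed:
  assumes "\<zeta> \<noteq> 0"
  shows "poly (reversed f) \<zeta> = \<zeta> ^ degree f * cnj (poly f (1 / cnj \<zeta>))"
proof -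
  have "poly (map_poly cnj g) \<zeta> = cnj (poly g (cnj \<zeta>))" for g
    by (induction g) (simp_all add: map_poly_pCons)
  then have "poly (reversed f) \<zeta> = cnj (poly (reflect_poly f) (cnj \<zeta>))"
    by (simp only: reversed_def)
  also have "poly (reflect_poly f) (cnj \<zeta>) = cnj \<zeta> ^ degree f * poly f (inverse (cnj \<zeta>))"
    using assms by (intro poly_reflect_poly_nz) simp
  finally show ?thesis
    by (simp add: inverse_eq_divide)
qed

definition rho :: "complex \<Rightarrow> real" where
  "rho a = sqrt (1 - (cmod a)\<^sup>2)"

definition verblunsky :: "complex measure \<Rightarrow> nat \<Rightarrow> complex" where
  "verblunsky \<mu> n = (THE a. cmod a < 1 \<and>
     (\<forall>\<zeta>. complex_of_real (rho a) * poly (orthonormal_polys \<mu> (Suc n)) \<zeta> =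
          \<zeta> * poly (orthonormal_polys \<mu> n) \<zeta>
            - cnj a * poly (reversed (orthonormal_polys \<mu> n)) \<zeta>))"

definition F :: "complex measure \<Rightarrow> nat \<Rightarrow> nat \<Rightarrow> complex" where
  "F \<mu> k n = L2_inner \<mu> (poly (reversed (orthonormal_polys \<mu> n)))
                         (\<lambda>\<zeta>. \<zeta> ^ k * poly (orthonormal_polys \<mu> n) \<zeta>)"


section \<open>The measure and the bases attached to a homogeneous polynomial\<close>

text \<open>\<open>p(\<zeta>,1)\<close> as a polynomial in \<open>\<zeta>\<close>.\<close>
definition dehomogenize :: "complex poly poly \<Rightarrow> complex poly" where
  "dehomogenize p = poly p 1"

definition poly_measure :: "complex poly poly \<Rightarrow> complex measure" where
  "poly_measure p = density circle_measure
     (\<lambda>\<zeta>. ennreal ((cmod (poly (dehomogenize p) \<zeta>))\<^sup>2 /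
                   (\<integral>\<xi>. (cmod (poly (dehomogenize p) \<xi>))\<^sup>2 \<partial>circle_measure)))"

definition e_basis :: "complex poly poly \<Rightarrow> nat \<Rightarrow> complex poly poly" where
  "e_basis p n = smult [:complex_of_real (1 / hardy_norm (taylor p)):]
     (p * homogenize n (reversed (orthonormal_polys (poly_measure p) n)))"

definition f_basis :: "complex poly poly \<Rightarrow> nat \<Rightarrow> complex poly poly" where
  "f_basis p n = smult [:complex_of_real (1 / hardy_norm (taylor p)):]
     (p * homogenize n (orthonormal_polys (poly_measure p) n))"

text \<open>
  The number \<open>\<Sigma>\<^sub>k([p])\<close>, a priori in \<open>[0,\<infinity>]\<close>.
\<close>
definition Sigma_k :: "nat \<Rightarrow> complex poly poly \<Rightarrow> ennreal" where
  "Sigma_k k p = (\<Sum>\<^sub>\<infinity>(j, n).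
     ennreal ((cmod (hardy_inner (taylor (wpow k * e_basis p j))
                                 (taylor (zpow k * f_basis p n))))\<^sup>2))"


section \<open>CMV matrices\<close>

type_synonym inf_matrix = "nat \<Rightarrow> nat \<Rightarrow> complex"

text \<open>For the banded matrices considered here, the sum has only finitely many non-zero terms.\<close>
definition mmult :: "inf_matrix \<Rightarrow> inf_matrix \<Rightarrow> inf_matrix" where
  "mmult A B = (\<lambda>i j. \<Sum>\<^sub>\<infinity>l. A i l * B l j)"

primrec mpow :: "inf_matrix \<Rightarrow> nat \<Rightarrow> inf_matrix" where
  "mpow A 0 = (\<lambda>i j. if i = j then 1 else 0)"
| "mpow A (Suc k) = mmult A (mpow A k)"

text \<open>Only the indices 0 and 1 of the 2 by 2 matrix \<open>\<Theta>(a)\<close> are used.\<close>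
definition Theta :: "complex \<Rightarrow> inf_matrix" where
  "Theta a i j = (if i = 0 \<and> j = 0 then a
                  else if i = 1 \<and> j = 1 then - cnj a
                  else complex_of_real (rho a))"

text \<open>The direct sum of the 2 by 2 matrices \<open>B 0\<close>, \<open>B 1\<close>, \<open>B 2\<close>, and so on.\<close>
definition block_sum :: "(nat \<Rightarrow> inf_matrix) \<Rightarrow> inf_matrix" where
  "block_sum B i j = (if i div 2 = j div 2 then B (i div 2) (i mod 2) (j mod 2) else 0)"

definition L_mat :: "(nat \<Rightarrow> complex) \<Rightarrow> inf_matrix" where
  "L_mat \<alpha> = block_sum (\<lambda>b. Theta (\<alpha> (2 * b)))"

definition M_mat :: "(nat \<Rightarrow> complex) \<Rightarrow> inf_matrix" where
  "M_mat \<alpha> i j = (case (i, j) of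
       (0, 0) \<Rightarrow> 1
     | (Suc i', Suc j') \<Rightarrow> block_sum (\<lambda>b. Theta (\<alpha> (2 * b + 1))) i' j'
     | _ \<Rightarrow> 0)"

definition C_mat :: "(nat \<Rightarrow> complex) \<Rightarrow> inf_matrix" where
  "C_mat \<alpha> = mmult (L_mat \<alpha>) (M_mat \<alpha>)"

end

theory Submission
  imports Defs
begin

text \<open>
  On the circle, \<open>\<eta>\<^sub>2\<^sub>m = \<zeta>\<^bsup>-m\<^esup> \<phi>\<^sub>2\<^sub>m\<^sup>*\<close>, \<open>\<eta>\<^sub>2\<^sub>m\<^sub>+\<^sub>1 = \<zeta>\<^bsup>-m\<^esup> \<phi>\<^sub>2\<^sub>m\<^sub>+\<^sub>1\<close> and the conjugates \<open>\<xi>\<^sub>n = cnj \<eta>\<^sub>n\<close> are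
  two orthonormal systems (the CMV bases). The Szego recursion says exactly that \<open>L\<close> is the matrix of
  \<open>\<zeta> \<xi>\<close> with respect to \<open>\<eta>\<close> and \<open>M\<close> that of \<open>\<eta>\<close> with respect to \<open>\<xi>\<close>, so that
  \<open>F\<^sub>k(2m) = \<langle>\<eta>\<^sub>2\<^sub>m, \<zeta>\<^sup>k \<xi>\<^sub>2\<^sub>m\<rangle>\<close> and \<open>F\<^sub>k(2m+1) = \<langle>\<xi>\<^sub>2\<^sub>m\<^sub>+\<^sub>1, \<zeta>\<^bsup>k-1\<^esup> \<eta>\<^sub>2\<^sub>m\<^sub>+\<^sub>1\<rangle>\<close> are matrix entries of words in \<open>L\<close> and \<open>M\<close>.
  For \<open>j \<noteq> n\<close> the polynomials \<open>w\<^sup>k e\<^sub>j\<close> and \<open>z\<^sup>k f\<^sub>n\<close> are homogeneous of different degrees, hence orthogonal.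

  For square summability, a monic polynomial \<open>f\<close> has \<open>\<parallel>f q\<parallel> \<ge> \<bar>lead_coeff q\<bar>\<close> on the circle, which bounds the
  products \<open>\<Prod>(1 - \<bar>\<alpha>\<^sub>n\<bar>\<^sup>2)\<close> from below and gives \<open>\<alpha> \<in> \<ell>\<^sup>2\<close>. Applying the recursion \<open>k\<close> times to \<open>\<zeta>\<^sup>k \<phi>\<^sub>n\<close> gives
  \<open>\<bar>F\<^sub>k(n)\<bar> \<le> \<bar>\<alpha>\<^sub>n\<bar> + \<dots> + \<bar>\<alpha>\<^bsub>n+k-1\<^esub>\<bar>\<close>.
\<close>

section \<open>Banded matrices\<close>

definition banded :: "nat \<Rightarrow> inf_matrix \<Rightarrow> bool" where
  "banded w A \<longleftrightarrow> (\<forall>i j. A i j \<noteq> 0 \<longrightarrow> i \<le> j + w \<and> j \<le> i + w)"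

lemma bandedD:
  assumes "banded w A" "A i j \<noteq> 0"
  shows "i \<le> j + w" "j \<le> i + w"
  using assms unfolding banded_def by blast+

lemma mmult_eq_sum:
  assumes "finite S" "\<And>l. l \<notin> S \<Longrightarrow> A i l * B l j = 0"
  shows "mmult A B i j = (\<Sum>l\<in>S. A i l * B l j)"
proof -
  have "mmult A B i j = (\<Sum>\<^sub>\<infinity>l\<in>S. A i l * B l j)"
    unfolding mmult_def using assms(2) by (intro infsum_cong_neutral) auto
  then show ?thesis
    using assms(1) by simp
qed

lemma mmult_banded_left:
  assumes "banded w A" "i + w \<le> N"
  shows "mmult A B i j = (\<Sum>l\<le>N. A i l * B l j)"
proof (rule mmult_eq_sum)
  fix l assume "l \<notin> {..N}"
  then show "A i l * B l j = 0"
    using bandedD(2)[OF assms(1), of i l] assms(2) by force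
qed simp

lemma mmult_banded_right:
  assumes "banded w B" "j + w \<le> N"
  shows "mmult A B i j = (\<Sum>l\<le>N. A i l * B l j)"
proof (rule mmult_eq_sum)
  fix l assume "l \<notin> {..N}"
  then show "A i l * B l j = 0"
    using bandedD(1)[OF assms(1), of l j] assms(2) by force
qed simp

lemma banded_mmult:
  assumes "banded v A" "banded w B"
  shows "banded (v + w) (mmult A B)"
  unfolding banded_def
proof (intro allI impI)
  fix i j assume "mmult A B i j \<noteq> 0"
  then have "(\<Sum>l\<le>i + v. A i l * B l j) \<noteq> 0"
    by (simp add: mmult_banded_left[OF assms(1) order_refl])
  then obtain l where "A i l * B l j \<noteq> 0"
    by (meson sum.neutral)
  then have "A i l \<noteq> 0" "B l j \<noteq> 0"
    by auto
  then show "i \<le> j + (v + w) \<and> j \<le> i + (v + w)"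
    using bandedD[OF assms(1)] bandedD[OF assms(2)] by fastforce
qed

text \<open>Row \<open>i\<close> of \<open>A\<close> and column \<open>j\<close> of \<open>C\<close>
  have finite support, so both bracketings are one finite double sum over a common range
  \<open>N\<close>.\<close>

lemma mmult_assoc:
  assumes A: "banded a A" and C: "banded c C"
  shows "mmult (mmult A B) C = mmult A (mmult B C)"
proof (intro ext)
  fix i j
  define N where "N = i + j + a + c"
  have "mmult (mmult A B) C i j = (\<Sum>l\<le>N. (\<Sum>k\<le>N. A i k * B k l) * C l j)"
    by (subst mmult_banded_right[OF C, of _ N], simp add: N_def,
        subst mmult_banded_left[OF A, of _ N], simp_all add: N_def)
  also have "\<dots> = (\<Sum>k\<le>N. A i k * (\<Sum>l\<le>N. B k l * C l j))"
    unfolding sum_distrib_left sum_distrib_right by (subst sum.swap) (simp add: mult_ac)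
  also have "\<dots> = mmult A (mmult B C) i j"
    by (subst mmult_banded_left[OF A, of _ N], simp add: N_def,
        subst mmult_banded_right[OF C, of _ N], simp_all add: N_def)
  finally show "mmult (mmult A B) C i j = mmult A (mmult B C) i j" .
qed

lemma banded_id: "banded 0 (\<lambda>i j. if i = j then 1 else 0)"
  by (auto simp: banded_def)

lemma mmult_id_left [simp]: "mmult (\<lambda>i j. if i = j then 1 else 0) A = A"
proof (intro ext)
  fix i j
  show "mmult (\<lambda>i j. if i = j then 1 else 0) A i j = A i j"
    by (subst mmult_eq_sum[of "{i}"]) auto
qed

lemma mmult_id_right [simp]: "mmult A (\<lambda>i j. if i = j then 1 else 0) = A"
proof (intro ext)
  fix i j
  show "mmult A (\<lambda>i j. if i = j then 1 else 0) i j = A i j"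
    by (subst mmult_eq_sum[of "{j}"]) auto
qed

lemma banded_mpow: "banded w A \<Longrightarrow> banded (w * k) (mpow A k)"
  by (induction k) (simp_all add: banded_id banded_mmult)

lemma mpow_Suc_right:
  assumes "banded w A"
  shows "mpow A (Suc k) = mmult (mpow A k) A"
proof (induction k)
  case (Suc k)
  have "mpow A (Suc (Suc k)) = mmult A (mmult (mpow A k) A)"
    using Suc by simp
  also have "\<dots> = mmult (mpow A (Suc k)) A"
    using assms by (simp add: mmult_assoc[where a = w and c = w])
  finally show ?case .
qed simp

text \<open>Only the entries of \<open>X\<close> reached from row \<open>i\<close> and column
  \<open>j\<close> of \<open>A\<close> enter; this controls the dependence window of a word at its
  outer factors.\<close>

lemma mmult_sandwich_cong:
  assumes "\<And>r. A i r = A' i r" "\<And>s. A s j = A' s j"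
    and "\<And>r s. A i r \<noteq> 0 \<Longrightarrow> A s j \<noteq> 0 \<Longrightarrow> X r s = X' r s"
  shows "mmult A (mmult X A) i j = mmult A' (mmult X' A') i j"
proof -
  have "A i r * mmult X A r j = A' i r * mmult X' A' r j" for r
  proof (cases "A i r = 0")
    case True
    then show ?thesis
      using assms(1)[of r] by simp
  next
    case False
    have "X r s * A s j = X' r s * A' s j" for s
      using assms(2)[of s] assms(3)[OF False, of s] by (cases "A s j = 0") auto
    then show ?thesis
      using assms(1)[of r] by (simp add: mmult_def)
  qed
  then show ?thesis
    by (simp add: mmult_def[of A] mmult_def[of A'])
qed


section \<open>CMV matrices\<close>

lemma L_mat_eq:
  "L_mat \<alpha> i j =
    (if even i then
       (if j = i then \<alpha> i else if j = Suc i then complex_of_real (rho (\<alpha> i)) else 0)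
     else
       (if j = i then - cnj (\<alpha> (i - 1)) else if Suc j = i then complex_of_real (rho (\<alpha> (i - 1))) else 0))"
proof (cases "even i")
  case True
  then obtain b where "i = 2 * b" by blast
  then show ?thesis
    by (cases "even j") (auto simp: L_mat_def block_sum_def Theta_def elim!: evenE oddE)
next
  case False
  then obtain b where "i = 2 * b + 1" by (meson oddE)
  then show ?thesis
    by (cases "even j") (auto simp: L_mat_def block_sum_def Theta_def elim!: evenE oddE)
qed

lemma M_mat_eq:
  "M_mat \<alpha> i j =
    (if odd i then
       (if j = i then \<alpha> i else if j = Suc i then complex_of_real (rho (\<alpha> i)) else 0)
     else if i = 0 then (if j = 0 then 1 else 0)
     else
       (if j = i then - cnj (\<alpha> (i - 1)) else if Suc j = i then complex_of_real (rho (\<alpha> (i - 1))) else 0))"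
proof (cases i; cases j)
  fix i' j' assume *: "i = Suc i'" "j = Suc j'"
  then have "M_mat \<alpha> i j = L_mat (\<lambda>n. \<alpha> (Suc n)) i' j'"
    by (simp add: M_mat_def L_mat_def)
  then show ?thesis
    by (auto simp: * L_mat_eq elim!: oddE)
qed (auto simp: M_mat_def)

lemma banded_L_mat: "banded 1 (L_mat \<alpha>)"
  by (auto simp: banded_def L_mat_eq split: if_splits)

lemma banded_M_mat: "banded 1 (M_mat \<alpha>)"
  by (auto simp: banded_def M_mat_eq split: if_splits)

lemma banded_C_mat: "banded 2 (C_mat \<alpha>)"
  using banded_mmult[OF banded_L_mat banded_M_mat] by (simp add: C_mat_def numeral_2_eq_2)

section \<open>Alternating words in \<open>L\<close> and \<open>M\<close> and their dependence on
  \<alpha>\<close>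

definition even_word :: "(nat \<Rightarrow> complex) \<Rightarrow> nat \<Rightarrow> inf_matrix" where
  "even_word \<alpha> k = mmult (mpow (C_mat \<alpha>) k) (L_mat \<alpha>)"

definition odd_word :: "(nat \<Rightarrow> complex) \<Rightarrow> nat \<Rightarrow> inf_matrix" where
  "odd_word \<alpha> k = mmult (M_mat \<alpha>) (mpow (C_mat \<alpha>) k)"

lemma even_word_0 [simp]: "even_word \<alpha> 0 = L_mat \<alpha>"
  and odd_word_0 [simp]: "odd_word \<alpha> 0 = M_mat \<alpha>"
  by (simp_all add: even_word_def odd_word_def)

text \<open>The words are the palindromes L M L ... L and M L M ... M with \<open>2 * k + 1\<close>
  factors. Stripping both outer letters of one leaves the other, which allows a mutual
  induction.\<close>

lemma even_word_Suc:
  "even_word \<alpha> (Suc k) = mmult (L_mat \<alpha>) (mmult (odd_word \<alpha> k) (L_mat \<alpha>))"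
proof -
  note banded_Ck = banded_mpow[OF banded_C_mat, of k \<alpha>]
  have "even_word \<alpha> (Suc k) = mmult (mmult (mmult (L_mat \<alpha>) (M_mat \<alpha>)) (mpow (C_mat \<alpha>) k)) (L_mat \<alpha>)"
    by (simp add: even_word_def flip: C_mat_def)
  then show ?thesis
    by (simp add: odd_word_def mmult_assoc[OF banded_L_mat banded_Ck]
        mmult_assoc[OF banded_L_mat banded_L_mat])
qed

lemma odd_word_Suc:
  "odd_word \<alpha> (Suc k) = mmult (M_mat \<alpha>) (mmult (even_word \<alpha> k) (M_mat \<alpha>))"
proof -
  note banded_Ck = banded_mpow[OF banded_C_mat, of k \<alpha>]
  have "odd_word \<alpha> (Suc k) = mmult (M_mat \<alpha>) (mmult (mpow (C_mat \<alpha>) k) (mmult (L_mat \<alpha>) (M_mat \<alpha>)))"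
    by (simp add: odd_word_def mpow_Suc_right[OF banded_C_mat] del: mpow.simps flip: C_mat_def)
  then show ?thesis
    by (simp add: even_word_def mmult_assoc[OF banded_Ck banded_M_mat])
qed

lemma L_mat_row_cong:
  assumes "\<And>l. i \<le> l + 1 \<Longrightarrow> l \<le> i \<Longrightarrow> \<alpha> l = \<beta> l"
  shows "L_mat \<alpha> i r = L_mat \<beta> i r" "L_mat \<alpha> r i = L_mat \<beta> r i"
  using assms by (auto simp: L_mat_eq)

lemma M_mat_row_cong:
  assumes "\<And>l. i \<le> l + 1 \<Longrightarrow> l \<le> i \<Longrightarrow> \<alpha> l = \<beta> l"
  shows "M_mat \<alpha> i r = M_mat \<beta> i r" "M_mat \<alpha> r i = M_mat \<beta> r i"
  using assms by (auto simp: M_mat_eq)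

text \<open>Row and column \<open>i\<close> of \<open>L\<close> and \<open>M\<close> involve only
  \<open>\<alpha> (i - 1)\<close> and \<open>\<alpha> i\<close>, and an outer factor moves an index
  by at most one, so each wrapping widens the window by one on either side.\<close>

lemma word_cong:
  assumes "\<And>l. min i j \<le> l + k + 1 \<Longrightarrow> l \<le> max i j + k \<Longrightarrow> \<alpha> l = \<beta> l"
  shows "even_word \<alpha> k i j = even_word \<beta> k i j \<and> odd_word \<alpha> k i j = odd_word \<beta> k i j"
  using assms
proof (induction k arbitrary: i j)
  case 0
  have "L_mat \<alpha> i j = L_mat \<beta> i j"
    using 0 by (auto simp: L_mat_eq)
  moreover have "M_mat \<alpha> i j = M_mat \<beta> i j"
    using 0 by (auto simp: M_mat_eq)
  ultimately show ?case
    by simp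
next
  case (Suc k)
  have rows: "\<And>l. i \<le> l + 1 \<Longrightarrow> l \<le> i \<Longrightarrow> \<alpha> l = \<beta> l" "\<And>l. j \<le> l + 1 \<Longrightarrow> l \<le> j \<Longrightarrow> \<alpha> l = \<beta> l"
    using Suc.prems by force+
  have IH: "even_word \<alpha> k r s = even_word \<beta> k r s \<and> odd_word \<alpha> k r s = odd_word \<beta> k r s"
    if "i \<le> r + 1" "r \<le> i + 1" "j \<le> s + 1" "s \<le> j + 1" for r s
    using that by (intro Suc.IH Suc.prems) auto
  have "even_word \<alpha> (Suc k) i j = even_word \<beta> (Suc k) i j"
    unfolding even_word_Suc
    by (rule mmult_sandwich_cong)
      (use IH bandedD[OF banded_L_mat] L_mat_row_cong rows in blast)+
  moreover have "odd_word \<alpha> (Suc k) i j = odd_word \<beta> (Suc k) i j"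
    unfolding odd_word_Suc
    by (rule mmult_sandwich_cong)
      (use IH bandedD[OF banded_M_mat] M_mat_row_cong rows in blast)+
  ultimately show ?case
    by blast
qed

text \<open>
  The generic window of \<open>word_cong\<close> is too wide by one on both sides; on the diagonal, the two outer
  factors only connect \<open>n\<close> with the other index \<open>n + 1\<close> of its block.
\<close>
lemma word_diag_cong:
  assumes "\<And>l. n \<le> l + k \<Longrightarrow> l \<le> n + k \<Longrightarrow> \<alpha> l = \<beta> l"
  shows "even n \<Longrightarrow> even_word \<alpha> k n n = even_word \<beta> k n n"
    and "odd n \<Longrightarrow> odd_word \<alpha> k n n = odd_word \<beta> k n n"
proof -
  have eq: "\<alpha> n = \<beta> n"
    by (rule assms) auto
  \<comment> \<open>With both indices in \<open>{n, n + 1}\<close> and \<open>k = Suc k'\<close>,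
    the window of \<open>word_cong\<close> is exactly \<open>n - k\<close> to
    \<open>n + k\<close>.\<close>
  have IH: "even_word \<alpha> k' r s = even_word \<beta> k' r s \<and> odd_word \<alpha> k' r s = odd_word \<beta> k' r s"
    if "r = n \<or> r = Suc n" "s = n \<or> s = Suc n" "k = Suc k'" for r s k'
    using that by (intro word_cong assms) auto
  show "even_word \<alpha> k n n = even_word \<beta> k n n" if "even n"
  proof (cases k)
    case (Suc k')
    have "L_mat \<alpha> n r = L_mat \<beta> n r" "L_mat \<alpha> r n = L_mat \<beta> r n"
      "L_mat \<alpha> n r \<noteq> 0 \<Longrightarrow> r = n \<or> r = Suc n" "L_mat \<alpha> r n \<noteq> 0 \<Longrightarrow> r = n \<or> r = Suc n" for r
      using that eq by (auto simp: L_mat_eq split: if_splits)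
    then show ?thesis
      unfolding Suc even_word_Suc using IH Suc by (intro mmult_sandwich_cong) blast+
  qed (use that eq in \<open>simp add: L_mat_eq\<close>)
  show "odd_word \<alpha> k n n = odd_word \<beta> k n n" if "odd n"
  proof (cases k)
    case (Suc k')
    have "M_mat \<alpha> n r = M_mat \<beta> n r" "M_mat \<alpha> r n = M_mat \<beta> r n"
      "M_mat \<alpha> n r \<noteq> 0 \<Longrightarrow> r = n \<or> r = Suc n" "M_mat \<alpha> r n \<noteq> 0 \<Longrightarrow> r = n \<or> r = Suc n" for r
      using that eq by (auto simp: M_mat_eq split: if_splits)
    then show ?thesis
      unfolding Suc odd_word_Suc using IH Suc by (intro mmult_sandwich_cong) blast+
  qed (use that eq in \<open>simp add: M_mat_eq\<close>)
qed

section \<open>Expansions of one system of functions in another\<close>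

text \<open>
  Coefficients are conjugated because \<open>L2_inner\<close> is conjugate-linear in its second argument: for
  orthonormal \<open>v\<close>, \<open>A i j\<close> is the inner product of \<open>v i\<close> with \<open>u j\<close>.
\<close>
definition expansion :: "nat \<Rightarrow> inf_matrix \<Rightarrow> (nat \<Rightarrow> complex \<Rightarrow> complex) \<Rightarrow> (nat \<Rightarrow> complex \<Rightarrow> complex) \<Rightarrow> bool" where
  "expansion w A u v \<longleftrightarrow> banded w A \<and>
     (\<forall>j N \<zeta>. cmod \<zeta> = 1 \<longrightarrow> j + w \<le> N \<longrightarrow> u j \<zeta> = (\<Sum>i\<le>N. cnj (A i j) * v i \<zeta>))"

text \<open>An expansion holds for every truncation \<open>N\<close> beyond the band, so all
  \<open>u l\<close> with \<open>l \<le> j + b\<close> can be expanded over the same range and the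
  two sums swapped.\<close>

lemma expansion_mmult:
  assumes "expansion a A u v" "expansion b B t u"
  shows "expansion (a + b) (mmult A B) t v"
proof -
  have A: "banded a A" and B: "banded b B"
    using assms by (auto simp: expansion_def)
  have "t j \<zeta> = (\<Sum>i\<le>N. cnj (mmult A B i j) * v i \<zeta>)"
    if \<zeta>: "cmod \<zeta> = 1" and N: "j + (a + b) \<le> N" for j N \<zeta>
  proof -
    have "t j \<zeta> = (\<Sum>l\<le>j + b. cnj (B l j) * u l \<zeta>)"
      using assms(2) \<zeta> by (auto simp: expansion_def)
    also have "\<dots> = (\<Sum>l\<le>j + b. cnj (B l j) * (\<Sum>i\<le>N. cnj (A i l) * v i \<zeta>))"
    proof (rule sum.cong)
      fix l assume "l \<in> {..j + b}"
      then have "u l \<zeta> = (\<Sum>i\<le>N. cnj (A i l) * v i \<zeta>)"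
        using assms(1) \<zeta> N by (auto simp: expansion_def)
      then show "cnj (B l j) * u l \<zeta> = cnj (B l j) * (\<Sum>i\<le>N. cnj (A i l) * v i \<zeta>)"
        by simp
    qed simp
    also have "\<dots> = (\<Sum>i\<le>N. cnj (\<Sum>l\<le>j + b. A i l * B l j) * v i \<zeta>)"
      unfolding sum_distrib_left cnj_sum sum_distrib_right by (subst sum.swap) (simp add: mult_ac)
    finally show ?thesis
      by (simp add: mmult_banded_right[OF B order_refl])
  qed
  then show ?thesis
    using banded_mmult[OF A B] by (simp add: expansion_def)
qed

lemma expansion_mult_power:
  assumes "expansion w A u v"
  shows "expansion w A (\<lambda>j \<zeta>. \<zeta> ^ k * u j \<zeta>) (\<lambda>j \<zeta>. \<zeta> ^ k * v j \<zeta>)"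
proof -
  have "\<zeta> ^ k * u j \<zeta> = (\<Sum>i\<le>N. cnj (A i j) * (\<zeta> ^ k * v i \<zeta>))"
    if "cmod \<zeta> = 1" "j + w \<le> N" for j N \<zeta>
  proof -
    have "u j \<zeta> = (\<Sum>i\<le>N. cnj (A i j) * v i \<zeta>)"
      using assms that by (auto simp: expansion_def)
    then show ?thesis
      by (simp add: sum_distrib_left mult_ac)
  qed
  then show ?thesis
    using assms by (auto simp: expansion_def)
qed

lemma expansion_mpow:
  assumes "expansion w A (\<lambda>j \<zeta>. \<zeta> * u j \<zeta>) u"
  shows "expansion (w * k) (mpow A k) (\<lambda>j \<zeta>. \<zeta> ^ k * u j \<zeta>) u"
proof (induction k)
  case 0
  have "u j \<zeta> = (\<Sum>i\<le>N. cnj (if i = j then 1 else 0) * u i \<zeta>)" if "j \<le> N" for j N \<zeta>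
    by (subst sum.mono_neutral_right[of _ "{j}"]) (use that in auto)
  then show ?case
    by (simp add: expansion_def banded_id)
next
  case (Suc k)
  have "expansion (w + w * k) (mmult A (mpow A k)) (\<lambda>j \<zeta>. \<zeta> * (\<zeta> ^ k * u j \<zeta>)) u"
    using expansion_mult_power[OF Suc, of 1] by (intro expansion_mmult[OF assms]) simp
  then show ?case
    by (simp add: mult.assoc)
qed


section \<open>Orthonormal polynomials of a nontrivial measure on the unit circle\<close>

lemma poly_reversed_circle:
  assumes "cmod \<zeta> = 1"
  shows "poly (reversed f) \<zeta> = \<zeta> ^ degree f * cnj (poly f \<zeta>)"
proof -
  have "\<zeta> \<noteq> 0" "1 / cnj \<zeta> = \<zeta>"
    using assms by (auto simp: divide_eq_eq complex_norm_square[symmetric] simp flip: complex_norm_square)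
  then show ?thesis
    by (simp add: poly_reversed)
qed

lemma cnj_mult_circle: "cmod \<zeta> = 1 \<Longrightarrow> \<zeta> * cnj \<zeta> = 1"
  by (simp flip: complex_norm_square)

lemma power_mult_cnj_circle: "cmod \<zeta> = 1 \<Longrightarrow> \<zeta> ^ k * cnj \<zeta> ^ k = 1"
  by (simp add: cnj_mult_circle flip: power_mult_distrib)

lemma degree_reversed_le: "degree (reversed f) \<le> degree f"
  by (simp add: reversed_def degree_map_poly degree_reflect_poly_le)

lemma coeff_0_reversed: "coeff (reversed f) 0 = cnj (lead_coeff f)"
  by (simp add: reversed_def coeff_map_poly)

lemma L2_inner_cnj: "L2_inner \<mu> g f = cnj (L2_inner \<mu> f g)"
  unfolding L2_inner_def by (subst Bochner_Integration.integral_cnj[symmetric]) (simp add: mult.commute)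

lemma rho_pos: "cmod a < 1 \<Longrightarrow> rho a > 0"
  by (simp add: rho_def power_less_one_iff abs_square_less_1)

lemma rho_sq: "cmod a < 1 \<Longrightarrow> complex_of_real (rho a) * complex_of_real (rho a) = 1 - a * cnj a"
proof -
  assume "cmod a < 1"
  then have "rho a * rho a = 1 - (cmod a)\<^sup>2"
    unfolding rho_def by (simp add: power_le_one_iff)
  then have "complex_of_real (rho a) * complex_of_real (rho a) = complex_of_real (1 - (cmod a)\<^sup>2)"
    by (metis of_real_mult)
  then show ?thesis
    by (simp add: complex_norm_square del: of_real_power flip: of_real_power)
qed

locale circle_measure_space = finite_measure \<mu> for \<mu> :: "complex measure" +
  assumes sets_eq_borel [measurable_cong]: "sets \<mu> = sets borel"
    and AE_circle: "AE \<zeta> in \<mu>. cmod \<zeta> = 1"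
begin

abbreviation "ip \<equiv> L2_inner \<mu>"

text \<open>Compactness of the circle bounds \<open>f\<close> almost everywhere, and \<mu> is
  finite.\<close>

lemma integrable_continuous:
  fixes f :: "complex \<Rightarrow> complex"
  assumes "continuous_on UNIV f"
  shows "integrable \<mu> f"
proof -
  have "compact (f ` sphere 0 1)"
    using assms by (intro compact_continuous_image) (auto intro: continuous_on_subset)
  then obtain B where "\<forall>y\<in>f ` sphere 0 1. cmod y \<le> B"
    using compact_imp_bounded bounded_iff by blast
  then have "AE \<zeta> in \<mu>. cmod (f \<zeta>) \<le> B"
    using AE_circle by (auto elim!: eventually_mono)
  moreover have "f \<in> borel_measurable \<mu>"
    using borel_measurable_continuous_onI[OF assms] measurable_cong_sets[OF sets_eq_borel refl] by blast
  ultimately show ?thesis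
    by (rule integrable_const_bound)
qed

text \<open>\<mu> is carried by the circle, so identities resting on
  \<open>\<zeta> * cnj \<zeta> = 1\<close> suffice although the integrands live on the whole
  plane.\<close>

lemma inner_cong:
  assumes "continuous_on UNIV f" "continuous_on UNIV g" "continuous_on UNIV f'" "continuous_on UNIV g'"
    and "\<And>\<zeta>. cmod \<zeta> = 1 \<Longrightarrow> f \<zeta> * cnj (g \<zeta>) = f' \<zeta> * cnj (g' \<zeta>)"
  shows "ip f g = ip f' g'"
  unfolding L2_inner_def
proof (rule integral_cong_AE)
  show "(\<lambda>\<zeta>. f \<zeta> * cnj (g \<zeta>)) \<in> borel_measurable \<mu>" "(\<lambda>\<zeta>. f' \<zeta> * cnj (g' \<zeta>)) \<in> borel_measurable \<mu>"
    using assms(1-4) by (auto intro!: borel_measurable_integrable integrable_continuous continuous_intros)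
  show "AE \<zeta> in \<mu>. f \<zeta> * cnj (g \<zeta>) = f' \<zeta> * cnj (g' \<zeta>)"
    using AE_circle assms(5) by (auto elim!: eventually_mono)
qed

lemma inner_add_left:
  assumes "continuous_on UNIV f" "continuous_on UNIV g" "continuous_on UNIV h"
  shows "ip (\<lambda>\<zeta>. f \<zeta> + g \<zeta>) h = ip f h + ip g h"
  unfolding L2_inner_def distrib_right using assms
  by (intro Bochner_Integration.integral_add integrable_continuous continuous_intros)

lemma inner_scale_left: "ip (\<lambda>\<zeta>. c * f \<zeta>) g = c * ip f g"
  unfolding L2_inner_def by (simp add: mult.assoc)

lemma inner_add_right:
  assumes "continuous_on UNIV f" "continuous_on UNIV g" "continuous_on UNIV h"
  shows "ip h (\<lambda>\<zeta>. f \<zeta> + g \<zeta>) = ip h f + ip h g"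
  using inner_add_left[OF assms] by (metis L2_inner_cnj complex_cnj_add)

lemma inner_scale_right: "ip f (\<lambda>\<zeta>. c * g \<zeta>) = cnj c * ip f g"
  by (metis L2_inner_cnj complex_cnj_mult inner_scale_left)

lemma inner_sum_right:
  assumes "\<And>i. i \<in> S \<Longrightarrow> continuous_on UNIV (g i)" "continuous_on UNIV f"
  shows "ip f (\<lambda>\<zeta>. \<Sum>i\<in>S. g i \<zeta>) = (\<Sum>i\<in>S. ip f (g i))"
  using assms
proof (induction S rule: infinite_finite_induct)
  case (insert x S)
  then have "ip f (\<lambda>\<zeta>. g x \<zeta> + (\<Sum>i\<in>S. g i \<zeta>)) = ip f (g x) + ip f (\<lambda>\<zeta>. \<Sum>i\<in>S. g i \<zeta>)"
    by (intro inner_add_right continuous_intros) auto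
  then show ?case
    using insert by simp
qed (simp_all add: L2_inner_def)

text \<open>The arguments are polynomials rather than functions, so that degrees are at hand;
  \<open>pCons 0 f\<close> stands for \<zeta> times \<open>f\<close>.\<close>

definition pinner :: "complex poly \<Rightarrow> complex poly \<Rightarrow> complex" where
  "pinner f g = ip (poly f) (poly g)"

lemma continuous_poly [continuous_intros]: "continuous_on A (poly (f :: complex poly))"
  by (intro continuous_intros)

lemma pinner_cnj: "pinner g f = cnj (pinner f g)"
  unfolding pinner_def by (rule L2_inner_cnj)

lemma pinner_add_left: "pinner (f + g) h = pinner f h + pinner g h"
  using inner_add_left[OF continuous_poly continuous_poly continuous_poly, of f g h]
  by (simp add: pinner_def poly_add[abs_def])

lemma pinner_smult_left: "pinner (smult c f) h = c * pinner f h"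
  using inner_scale_left[of c "poly f" "poly h"] by (simp add: pinner_def poly_smult[abs_def])

lemma pinner_diff_left: "pinner (f - g) h = pinner f h - pinner g h"
  using pinner_add_left[of f "smult (-1) g" h] pinner_smult_left[of "-1" g h] by simp

lemma pinner_add_right: "pinner h (f + g) = pinner h f + pinner h g"
  by (metis pinner_cnj complex_cnj_add pinner_add_left)

lemma pinner_diff_right: "pinner h (f - g) = pinner h f - pinner h g"
  by (metis pinner_cnj complex_cnj_diff pinner_diff_left)

lemma pinner_smult_right: "pinner h (smult c f) = cnj c * pinner h f"
  by (metis pinner_cnj complex_cnj_mult pinner_smult_left)

lemma pinner_sum_right: "pinner h (\<Sum>i\<in>S. f i) = (\<Sum>i\<in>S. pinner h (f i))"
proof (induction S rule: infinite_finite_induct)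
  case (insert x S)
  then show ?case by (simp add: pinner_add_right)
qed (simp_all add: pinner_def L2_inner_def)

lemma pinner_sum_left: "pinner (\<Sum>i\<in>S. f i) h = (\<Sum>i\<in>S. pinner (f i) h)"
  using pinner_sum_right[of h f S] by (subst (1 2) pinner_cnj) simp

lemmas pinner_linear = pinner_add_left pinner_diff_left pinner_smult_left
  pinner_add_right pinner_diff_right pinner_smult_right

lemma pinner_pCons_pCons [simp]: "pinner (pCons 0 f) (pCons 0 g) = pinner f g"
  unfolding pinner_def
proof (rule inner_cong)
  fix \<zeta> :: complex assume "cmod \<zeta> = 1"
  then have "\<zeta> * cnj \<zeta> = 1"
    by (rule cnj_mult_circle)
  then show "poly (pCons 0 f) \<zeta> * cnj (poly (pCons 0 g) \<zeta>) = poly f \<zeta> * cnj (poly g \<zeta>)"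
    by simp
qed (intro continuous_intros)+

text \<open>On the circle reversal is conjugation up to a power of \<zeta>; for equal degrees the
  powers cancel and conjugation swaps the arguments.\<close>

lemma pinner_reversed_reversed:
  assumes "degree f = degree g"
  shows "pinner (reversed f) (reversed g) = pinner g f"
  unfolding pinner_def
proof (rule inner_cong)
  fix \<zeta> :: complex assume "cmod \<zeta> = 1"
  then show "poly (reversed f) \<zeta> * cnj (poly (reversed g) \<zeta>) = poly g \<zeta> * cnj (poly f \<zeta>)"
    using power_mult_cnj_circle[of \<zeta> "degree g"] assms
    by (simp add: poly_reversed_circle)
qed (intro continuous_intros)+

lemma pinner_self: "pinner f f = complex_of_real (\<integral>\<zeta>. (cmod (poly f \<zeta>))\<^sup>2 \<partial>\<mu>)"
  unfolding pinner_def L2_inner_def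
  by (subst integral_complex_of_real[symmetric]) (simp only: complex_norm_square)

lemma pinner_self_real: "pinner f f = complex_of_real (Re (pinner f f))"
  by (simp add: pinner_self)

lemma pinner_0_right [simp]: "pinner f 0 = 0" and pinner_0_left [simp]: "pinner 0 f = 0"
  by (simp_all add: pinner_def L2_inner_def)

end

text \<open>This is infinite support in algebraic form; it makes \<open>pinner\<close> positive
  definite.\<close>

locale nontrivial_circle_measure_space = circle_measure_space +
  assumes nondegenerate: "f \<noteq> 0 \<Longrightarrow> \<not> (AE \<zeta> in \<mu>. poly f \<zeta> = 0)"
begin

lemma Re_pinner_self_pos:
  assumes "f \<noteq> 0"
  shows "Re (pinner f f) > 0"
proof -
  have int: "integrable \<mu> (\<lambda>\<zeta>. (cmod (poly f \<zeta>))\<^sup>2)"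
  proof -
    have "integrable \<mu> (\<lambda>\<zeta>. Re (poly f \<zeta> * cnj (poly f \<zeta>)))"
      by (intro integrable_Re integrable_continuous continuous_intros)
    then show ?thesis
      by (simp flip: complex_norm_square)
  qed
  have "(\<integral>\<zeta>. (cmod (poly f \<zeta>))\<^sup>2 \<partial>\<mu>) \<noteq> 0"
    using nondegenerate[OF assms] integral_nonneg_eq_0_iff_AE[OF int] by auto
  moreover have "(\<integral>\<zeta>. (cmod (poly f \<zeta>))\<^sup>2 \<partial>\<mu>) \<ge> 0"
    by (intro integral_nonneg_AE) auto
  ultimately show ?thesis
    by (simp add: pinner_self less_le)
qed

lemma pinner_self_eq_0: "pinner f f = 0 \<Longrightarrow> f = 0"
  using Re_pinner_self_pos by force

text \<open>Orthogonality to everything of lower degree, rather than to the other members of a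
  family, makes sense for a single \<open>n\<close>. Zero is listed separately because its degree is
  0, which is not below \<open>n = 0\<close>.\<close>

definition ortho_poly :: "nat \<Rightarrow> complex poly \<Rightarrow> bool" where
  "ortho_poly n P \<longleftrightarrow> degree P = n \<and> (\<exists>\<kappa>>0. lead_coeff P = complex_of_real \<kappa>) \<and> pinner P P = 1 \<and>
     (\<forall>f. f = 0 \<or> degree f < n \<longrightarrow> pinner P f = 0)"

lemma ortho_polyD:
  assumes "ortho_poly n P"
  shows "degree P = n" "P \<noteq> 0" "pinner P P = 1" "degree f < n \<Longrightarrow> pinner P f = 0"
    "\<exists>\<kappa>>0. lead_coeff P = complex_of_real \<kappa>"
  using assms unfolding ortho_poly_def by force+

text \<open>Cross-multiplying with the leading coefficients cancels the top term. The difference is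
  then orthogonal to \<open>P\<close> and \<open>Q\<close>, hence to itself, and the normalisation
  forces the two coefficients to agree.\<close>

lemma ortho_poly_unique:
  assumes "ortho_poly n P" "ortho_poly n Q"
  shows "P = Q"
proof -
  obtain a b where ab: "a > 0" "b > 0" "lead_coeff P = complex_of_real a" "lead_coeff Q = complex_of_real b"
    using assms unfolding ortho_poly_def by blast
  define R where "R = smult (complex_of_real b) P - smult (complex_of_real a) Q"
  have R: "R = 0 \<or> degree R < n"
  proof (rule ccontr)
    assume R0: "\<not> (R = 0 \<or> degree R < n)"
    have "degree R \<le> n"
      unfolding R_def using assms by (intro degree_diff_le order.trans[OF degree_smult_le]) (auto simp: ortho_poly_def)
    moreover have "coeff R n = 0"
      using ab assms by (simp add: R_def ortho_poly_def)
    ultimately show False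
      using R0 by (metis le_antisym leading_coeff_0_iff not_le)
  qed
  then have "pinner P R = 0" "pinner Q R = 0"
    using assms by (auto simp: ortho_poly_def)
  then have "pinner R R = 0"
    by (subst R_def) (simp add: pinner_linear)
  then have "R = 0"
    by (rule pinner_self_eq_0)
  then have eq: "smult (complex_of_real b) P = smult (complex_of_real a) Q"
    by (simp add: R_def)
  have "pinner (smult (complex_of_real b) P) (smult (complex_of_real b) P) = complex_of_real (b\<^sup>2)"
    using ortho_polyD(3)[OF assms(1)] by (simp add: pinner_linear power2_eq_square)
  moreover have "pinner (smult (complex_of_real a) Q) (smult (complex_of_real a) Q) = complex_of_real (a\<^sup>2)"
    using ortho_polyD(3)[OF assms(2)] by (simp add: pinner_linear power2_eq_square)
  ultimately have "b\<^sup>2 = a\<^sup>2"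
    unfolding eq using of_real_eq_iff by metis
  then have "a = b"
    using ab by (simp add: power2_eq_iff_nonneg)
  then have "smult (complex_of_real b) P = smult (complex_of_real b) Q"
    using eq by simp
  then show ?thesis
    using ab by (metis of_real_eq_0_iff order_less_irrefl smult_cancel)
qed

text \<open>On the circle the pairing of \<open>reversed P\<close> with
  \<open>\<zeta> ^ Suc i\<close> equals that of \<open>\<zeta> ^ (n - Suc i)\<close> with
  \<open>P\<close>. Thus \<open>reversed P\<close> is orthogonal to \<zeta>, ...,
  \<open>\<zeta> ^ n\<close>.\<close>

lemma pinner_reversed_pCons:
  assumes "ortho_poly n P" "degree f < n"
  shows "pinner (reversed P) (pCons 0 f) = 0"
proof -
  have "pinner (reversed P) (pCons 0 (monom c i)) = 0" if "i < n" for i c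
  proof -
    have "pinner (reversed P) (pCons 0 (monom c i)) = pinner (monom (cnj c) (n - Suc i)) P"
      unfolding pinner_def
    proof (rule inner_cong)
      fix \<zeta> :: complex assume \<zeta>: "cmod \<zeta> = 1"
      have "\<zeta> ^ n = \<zeta> ^ (n - Suc i) * \<zeta> ^ Suc i"
        using that by (simp flip: power_add power_Suc)
      then have "\<zeta> ^ n * cnj (\<zeta> ^ Suc i) = \<zeta> ^ (n - Suc i)"
        using power_mult_cnj_circle[OF \<zeta>, of "Suc i"] by (simp only: mult.assoc complex_cnj_power mult_1_right)
      moreover have "poly (reversed P) \<zeta> = \<zeta> ^ n * cnj (poly P \<zeta>)"
        using \<zeta> assms(1) by (simp add: poly_reversed_circle ortho_poly_def)
      moreover have "poly (pCons 0 (monom c i)) \<zeta> = c * \<zeta> ^ Suc i"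
        by (simp add: poly_monom)
      ultimately show "poly (reversed P) \<zeta> * cnj (poly (pCons 0 (monom c i)) \<zeta>) =
          poly (monom (cnj c) (n - Suc i)) \<zeta> * cnj (poly P \<zeta>)"
        by (simp only: poly_monom complex_cnj_mult) (metis mult.assoc mult.commute)
    qed (intro continuous_intros)+
    also have "\<dots> = cnj (pinner P (monom (cnj c) (n - Suc i)))"
      by (rule pinner_cnj)
    also have "pinner P (monom (cnj c) (n - Suc i)) = 0"
      using assms(1) that by (intro ortho_polyD) (auto intro: le_less_trans[OF degree_monom_le])
    finally show ?thesis
      by simp
  qed
  moreover have "pCons 0 f = (\<Sum>i\<le>degree f. pCons 0 (monom (coeff f i) i))"
  proof -
    have "pCons 0 f = [:0, 1:] * (\<Sum>i\<le>degree f. monom (coeff f i) i)"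
      by (subst poly_as_sum_of_monoms) simp
    then show ?thesis
      by (simp add: sum_distrib_left)
  qed
  ultimately show ?thesis
    using assms(2) by (simp add: pinner_sum_right)
qed

section \<open>The Szego recursion as a Gram-Schmidt step\<close>

definition szego_step :: "complex poly \<Rightarrow> complex poly" where
  "szego_step P = (let a = pinner (reversed P) (pCons 0 P) in
     smult (complex_of_real (1 / rho a)) (pCons 0 P - smult (cnj a) (reversed P)))"

text \<open>Both \<zeta> P and \<open>reversed P\<close> are orthogonal to \<zeta>, ...,
  \<open>\<zeta> ^ n\<close>. Since \<open>cnj a\<close> is the coefficient of the projection of
  \<zeta> P onto the unit vector \<open>reversed P\<close>, the difference \<open>R\<close> is
  orthogonal to \<open>reversed P\<close> too, hence to constants. Its squared norm
  \<open>1 - (cmod a)\<^sup>2\<close> is positive, so \<open>cmod a < 1\<close>.\<close>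

lemma ortho_poly_szego_step:
  assumes "ortho_poly n P"
  defines "a \<equiv> pinner (reversed P) (pCons 0 P)"
  shows "cmod a < 1" "ortho_poly (Suc n) (szego_step P)"
    "smult (complex_of_real (rho a)) (szego_step P) = pCons 0 P - smult (cnj a) (reversed P)"
proof -
  note P = ortho_polyD[OF assms(1)]
  define R where "R = pCons 0 P - smult (cnj a) (reversed P)"
  obtain \<kappa> where \<kappa>: "\<kappa> > 0" "lead_coeff P = complex_of_real \<kappa>"
    using P(5) by blast
  have deg_rev: "degree (reversed P) \<le> n"
    using degree_reversed_le P(1) by blast
  have rev1: "pinner (reversed P) (reversed P) = 1"
    using P(3) by (simp add: pinner_reversed_reversed)
  have shift: "pinner (pCons 0 P) (reversed P) = cnj a"
    unfolding a_def by (rule pinner_cnj)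
  have coeff_R: "coeff R (Suc n) = complex_of_real \<kappa>"
    using \<kappa> P(1) deg_rev by (simp add: R_def coeff_eq_0)
  have deg_R: "degree R = Suc n"
  proof (rule antisym)
    show "degree R \<le> Suc n"
      unfolding R_def using deg_rev P(1)
      by (intro degree_diff_le order.trans[OF degree_smult_le] order.trans[OF degree_pCons_le]) auto
    show "Suc n \<le> degree R"
      using coeff_R \<kappa> by (intro le_degree) simp
  qed
  have R_pCons: "pinner R (pCons 0 f) = 0" if "f = 0 \<or> degree f < n" for f
    using that pinner_reversed_pCons[OF assms(1), of f] P(4)[of f] by (auto simp: R_def pinner_linear)
  have R_rev: "pinner R (reversed P) = 0"
    by (simp add: R_def pinner_linear shift rev1)
  \<comment> \<open>The constant term of \<open>reversed P\<close> is the leading coefficient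
    \<open>\<kappa> > 0\<close> of \<open>P\<close>; the rest is \<zeta> times a polynomial that is
    zero or of degree below \<open>n\<close>, to which \<open>R_pCons\<close> applies.\<close>
  have R_1: "pinner R [:c:] = 0" for c
  proof -
    obtain b g where bg: "reversed P = pCons b g"
      by (cases "reversed P")
    have "b = complex_of_real \<kappa>"
      using coeff_0_reversed[of P] bg \<kappa> by simp
    then have "reversed P = smult (complex_of_real \<kappa>) [:1:] + pCons 0 g"
      by (simp add: bg)
    then have "pinner R (reversed P) = complex_of_real \<kappa> * pinner R [:1:] + pinner R (pCons 0 g)"
      by (simp only: pinner_linear complex_cnj_complex_of_real)
    moreover have "g = 0 \<or> degree g < n"
      using deg_rev bg by (auto simp: degree_pCons_eq_if split: if_splits)
    ultimately have "pinner R [:1:] = 0"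
      using R_rev R_pCons[of g] \<kappa>(1) by simp
    then show ?thesis
      using pinner_smult_right[of R c "[:1:]"] by simp
  qed
  have ortho_R: "pinner R f = 0" if "f = 0 \<or> degree f < Suc n" for f
  proof -
    obtain b g where bg: "f = pCons b g"
      by (cases f)
    have "g = 0 \<or> degree g < n"
      using that bg by (auto simp: degree_pCons_eq split: if_splits)
    moreover have "pinner R f = pinner R [:b:] + pinner R (pCons 0 g)"
      unfolding bg by (simp flip: pinner_add_right)
    ultimately show ?thesis
      using R_1 R_pCons by simp
  qed
  \<comment> \<open>\<open>R\<close> is orthogonal to \<open>reversed P\<close>, so only the summand
    \<zeta> P of the second argument contributes.\<close>
  have "pinner R R = pinner R (pCons 0 P)"
    by (subst (2) R_def) (simp add: pinner_linear R_rev)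
  also have "\<dots> = 1 - a * cnj a"
    by (simp add: R_def pinner_linear P(3) flip: a_def)
  finally have RR: "pinner R R = complex_of_real (1 - (cmod a)\<^sup>2)"
    by (simp add: complex_norm_square del: of_real_power flip: of_real_power)
  have "R \<noteq> 0"
    using deg_R by auto
  then have "1 - (cmod a)\<^sup>2 > 0"
    using Re_pinner_self_pos[of R] by (simp add: RR del: of_real_diff of_real_power)
  then show a: "cmod a < 1"
    by (simp add: abs_square_less_1)
  have step: "szego_step P = smult (complex_of_real (1 / rho a)) R"
    by (simp add: szego_step_def a_def R_def Let_def)
  have rho: "rho a > 0" "complex_of_real (rho a) * complex_of_real (rho a) = pinner R R"
    using rho_pos[OF a] rho_sq[OF a] RR by (simp_all add: complex_norm_square del: of_real_power flip: of_real_power)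
  show "smult (complex_of_real (rho a)) (szego_step P) = pCons 0 P - smult (cnj a) (reversed P)"
    using rho(1) by (simp add: step flip: R_def)
  show "ortho_poly (Suc n) (szego_step P)"
    unfolding ortho_poly_def
  proof (intro conjI allI impI)
    show "degree (szego_step P) = Suc n"
      using rho(1) deg_R by (simp add: step)
    show "\<exists>\<kappa>'>0. lead_coeff (szego_step P) = complex_of_real \<kappa>'"
      using rho(1) \<kappa>(1) coeff_R deg_R by (intro exI[of _ "\<kappa> / rho a"]) (simp add: step)
    show "pinner (szego_step P) (szego_step P) = 1"
      using rho(1) by (simp add: step pinner_linear field_simps flip: rho(2))
    show "pinner (szego_step P) f = 0" if "f = 0 \<or> degree f < Suc n" for f
      using ortho_R[OF that] by (simp add: step pinner_linear)
  qed
qed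

text \<open>Existence of the orthonormal polynomials: the recursion is iterated from the positive
  constant of norm one.\<close>

primrec szego_poly :: "nat \<Rightarrow> complex poly" where
  "szego_poly 0 = [:complex_of_real (1 / sqrt (Re (pinner 1 1))):]"
| "szego_poly (Suc n) = szego_step (szego_poly n)"

lemma ortho_poly_szego_poly: "ortho_poly n (szego_poly n)"
proof (induction n)
  case 0
  have pos: "Re (pinner 1 1) > 0"
    by (rule Re_pinner_self_pos) simp
  define r where "r = 1 / sqrt (Re (pinner 1 1))"
  have "szego_poly 0 = smult (complex_of_real r) 1"
    by (simp add: r_def one_pCons)
  then have "pinner (szego_poly 0) (szego_poly 0) = complex_of_real (r * r) * pinner 1 1"
    by (simp only: pinner_linear) simp
  also have "\<dots> = complex_of_real (r * r * Re (pinner 1 1))"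
    by (metis of_real_mult pinner_self_real)
  also have "r * r * Re (pinner 1 1) = 1"
    using pos by (simp add: r_def)
  finally show ?case
    using pos by (auto simp: ortho_poly_def intro!: exI[of _ r]) (auto simp: r_def)
next
  case (Suc n)
  then show ?case
    using ortho_poly_szego_step(2) by simp
qed

text \<open>The polynomials \<open>\<phi> d\<close> with \<open>d < n\<close> span everything of
  degree below \<open>n\<close>; the second direction peels off leading terms by induction on the
  degree.\<close>

lemma is_orthonormal_polys_iff:
  "is_orthonormal_polys \<mu> \<phi> \<longleftrightarrow> (\<forall>n. ortho_poly n (\<phi> n))"
proof
  assume \<phi>: "\<forall>n. ortho_poly n (\<phi> n)"
  have "pinner (\<phi> m) (\<phi> n) = (if m = n then 1 else 0)" for m n
  proof (cases m n rule: linorder_cases)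
    case less
    then have "pinner (\<phi> n) (\<phi> m) = 0"
      using \<phi> ortho_polyD(1,4) by metis
    then show ?thesis
      using less pinner_cnj[of "\<phi> m" "\<phi> n"] by simp
  next
    case equal
    then show ?thesis
      using \<phi> ortho_polyD(3) by auto
  next
    case greater
    then show ?thesis
      using \<phi> ortho_polyD(1,4) by (metis order_less_irrefl)
  qed
  then show "is_orthonormal_polys \<mu> \<phi>"
    using \<phi> unfolding is_orthonormal_polys_def pinner_def ortho_poly_def by blast
next
  assume \<phi>: "is_orthonormal_polys \<mu> \<phi>"
  then have deg: "degree (\<phi> n) = n" and lead: "\<exists>\<kappa>>0. lead_coeff (\<phi> n) = complex_of_real \<kappa>"
    and ip: "pinner (\<phi> m) (\<phi> n) = (if m = n then 1 else 0)" for m n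
    unfolding is_orthonormal_polys_def pinner_def by blast+
  have "pinner (\<phi> n) f = 0" if "f = 0 \<or> degree f < n" for n f
    using that
  proof (induction "degree f" arbitrary: f rule: less_induct)
    case less
    show ?case
    proof (cases "f = 0")
      case False
      define d where "d = degree f"
      define c where "c = coeff f d / coeff (\<phi> d) d"
      define g where "g = f - smult c (\<phi> d)"
      have "coeff (\<phi> d) d \<noteq> 0"
        using lead[of d] deg[of d] by force
      then have "coeff g d = 0"
        by (simp add: g_def c_def)
      moreover have "degree g \<le> d"
        unfolding g_def using deg[of d] d_def by (intro degree_diff_le order.trans[OF degree_smult_le]) auto
      ultimately have g: "g = 0 \<or> degree g < d"
        by (metis le_neq_implies_less leading_coeff_0_iff)
      have "d < n"
        using less.prems False by (simp add: d_def)
      have "pinner (\<phi> n) g = 0"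
      proof (cases "g = 0")
        case False
        then show ?thesis
          using g \<open>d < n\<close> by (intro less.hyps) (auto simp: d_def)
      qed simp
      moreover have "f = g + smult c (\<phi> d)"
        by (simp add: g_def)
      ultimately show ?thesis
        using ip[of n d] \<open>d < n\<close> by (simp add: pinner_linear)
    qed simp
  qed
  then show "\<forall>n. ortho_poly n (\<phi> n)"
    using deg lead ip unfolding ortho_poly_def by auto
qed

section \<open>Orthonormal polynomials and Verblunsky coefficients of \<mu>\<close>

definition \<phi> :: "nat \<Rightarrow> complex poly" where
  "\<phi> = orthonormal_polys \<mu>"

lemma \<phi>_eq_szego_poly: "\<phi> = szego_poly"
  unfolding \<phi>_def orthonormal_polys_def
proof (rule the_equality)
  show "is_orthonormal_polys \<mu> szego_poly"
    using ortho_poly_szego_poly is_orthonormal_polys_iff by blast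
  show "\<psi> = szego_poly" if "is_orthonormal_polys \<mu> \<psi>" for \<psi>
    using that ortho_poly_szego_poly ortho_poly_unique is_orthonormal_polys_iff by blast
qed

lemma ortho_poly_\<phi>: "ortho_poly n (\<phi> n)"
  by (simp add: \<phi>_eq_szego_poly ortho_poly_szego_poly)

definition \<alpha> :: "nat \<Rightarrow> complex" where
  "\<alpha> n = pinner (reversed (\<phi> n)) (pCons 0 (\<phi> n))"

lemma \<alpha>_less_1: "cmod (\<alpha> n) < 1"
  unfolding \<alpha>_def by (rule ortho_poly_szego_step(1)[OF ortho_poly_\<phi>])

lemma szego:
  "smult (complex_of_real (rho (\<alpha> n))) (\<phi> (Suc n)) = pCons 0 (\<phi> n) - smult (cnj (\<alpha> n)) (reversed (\<phi> n))"
  unfolding \<alpha>_def using ortho_poly_szego_step(3)[OF ortho_poly_\<phi>] by (simp add: \<phi>_eq_szego_poly)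

lemmas degree_\<phi> [simp] = ortho_polyD(1)[OF ortho_poly_\<phi>]
lemmas pinner_\<phi>_self [simp] = ortho_polyD(3)[OF ortho_poly_\<phi>]
lemmas pinner_\<phi>_lower = ortho_polyD(4)[OF ortho_poly_\<phi>]
lemmas pinner_reversed_\<phi>_pCons = pinner_reversed_pCons[OF ortho_poly_\<phi>]

lemma pinner_reversed_\<phi>_self [simp]: "pinner (reversed (\<phi> n)) (reversed (\<phi> n)) = 1"
  by (simp add: pinner_reversed_reversed)

lemma pinner_\<phi>_reversed_lower: "m < n \<Longrightarrow> pinner (reversed (\<phi> m)) (\<phi> n) = 0"
proof -
  assume "m < n"
  then have "pinner (\<phi> n) (reversed (\<phi> m)) = 0"
    using degree_reversed_le[of "\<phi> m"] by (intro pinner_\<phi>_lower) simp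
  then show ?thesis
    using pinner_cnj[of "reversed (\<phi> m)" "\<phi> n"] by simp
qed

lemma verblunsky_eq: "verblunsky \<mu> = \<alpha>"
proof
  fix n
  show "verblunsky \<mu> n = \<alpha> n"
    unfolding verblunsky_def \<phi>_def[symmetric]
  proof (rule the_equality, intro conjI allI)
    show "cmod (\<alpha> n) < 1"
      by (rule \<alpha>_less_1)
    show "complex_of_real (rho (\<alpha> n)) * poly (\<phi> (Suc n)) \<zeta> =
        \<zeta> * poly (\<phi> n) \<zeta> - cnj (\<alpha> n) * poly (reversed (\<phi> n)) \<zeta>" for \<zeta>
      using arg_cong[OF szego[of n], of "\<lambda>f. poly f \<zeta>"] by simp
    show "a = \<alpha> n" if a: "cmod a < 1 \<and> (\<forall>\<zeta>. complex_of_real (rho a) * poly (\<phi> (Suc n)) \<zeta> =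
        \<zeta> * poly (\<phi> n) \<zeta> - cnj a * poly (reversed (\<phi> n)) \<zeta>)" for a
    proof -
      have "poly (smult (complex_of_real (rho a)) (\<phi> (Suc n))) =
          poly (pCons 0 (\<phi> n) - smult (cnj a) (reversed (\<phi> n)))"
        using a by auto
      then have eq: "smult (complex_of_real (rho a)) (\<phi> (Suc n)) =
          pCons 0 (\<phi> n) - smult (cnj a) (reversed (\<phi> n))"
        by (simp add: poly_eq_poly_eq_iff)
      \<comment> \<open>Pairing the recursion with \<open>reversed (\<phi> n)\<close> isolates
        \<open>a\<close>, because \<open>\<phi> (Suc n)\<close> is orthogonal to all degrees up to
        \<open>n\<close>.\<close>
      have "0 = pinner (reversed (\<phi> n)) (smult (complex_of_real (rho a)) (\<phi> (Suc n)))"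
        by (simp add: pinner_linear pinner_\<phi>_reversed_lower)
      also have "\<dots> = \<alpha> n - a"
        by (simp add: eq pinner_linear \<alpha>_def)
      finally show "a = \<alpha> n"
        by simp
    qed
  qed
qed


subsection \<open>The CMV bases\<close>

text \<open>
  Negative powers of \<open>\<zeta>\<close> are written as powers of \<open>cnj \<zeta>\<close>, which keeps the functions continuous on the
  whole plane.
\<close>
definition \<eta> :: "nat \<Rightarrow> complex \<Rightarrow> complex" where
  "\<eta> i \<zeta> = cnj \<zeta> ^ (i div 2) * poly (if even i then reversed (\<phi> i) else \<phi> i) \<zeta>"

definition \<xi> :: "nat \<Rightarrow> complex \<Rightarrow> complex" where
  "\<xi> i \<zeta> = cnj \<zeta> ^ ((i + 1) div 2) * poly (if even i then \<phi> i else reversed (\<phi> i)) \<zeta>"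

lemma continuous_\<eta> [continuous_intros]: "continuous_on UNIV (\<eta> i)"
  unfolding \<eta>_def by (intro continuous_intros)

lemma continuous_\<xi> [continuous_intros]: "continuous_on UNIV (\<xi> i)"
  unfolding \<xi>_def by (intro continuous_intros)

text \<open>Conjugating \<open>\<phi> i\<close> or its reversal on the circle costs a factor
  \<open>cnj \<zeta> ^ i\<close>, and \<open>i - i div 2 = (i + 1) div 2\<close>; this is the
  exponent chosen in \<xi>.\<close>

lemma \<xi>_eq_cnj_\<eta>:
  assumes "cmod \<zeta> = 1"
  shows "\<xi> i \<zeta> = cnj (\<eta> i \<zeta>)"
proof (cases "even i")
  case True
  then obtain m where i: "i = 2 * m" by blast
  have "cnj \<zeta> ^ m * (cnj \<zeta> ^ m * \<zeta> ^ m) = cnj \<zeta> ^ m"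
    using power_mult_cnj_circle[OF assms, of m] by (simp add: mult.commute)
  then show ?thesis
    using assms power_mult_cnj_circle[OF assms, of m]
    by (simp add: i \<xi>_def \<eta>_def poly_reversed_circle power_mult power2_eq_square power_mult_distrib)
next
  case False
  then obtain m where i: "i = 2 * m + 1" by (meson oddE)
  have "cnj \<zeta> ^ (m + 1) * \<zeta> ^ (2 * m + 1) = \<zeta> ^ m"
  proof -
    have "\<zeta> ^ (2 * m + 1) = \<zeta> ^ m * \<zeta> ^ (m + 1)"
      by (simp flip: power_add power_Suc) (simp add: mult_2)
    then show ?thesis
      using power_mult_cnj_circle[OF assms, of "m + 1"] by (metis mult.assoc mult.commute mult_1_right)
  qed
  then show ?thesis
    using assms by (simp add: i \<xi>_def \<eta>_def poly_reversed_circle)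
      (metis mult.assoc power_Suc)
qed

text \<open>For \<open>j < i\<close> the powers combine to
  \<open>\<zeta> ^ (i div 2 - j div 2)\<close> in the second argument. If \<open>i\<close> is even,
  this exponent is positive and the product has degree at most \<open>i\<close>, so it is orthogonal
  to \<open>reversed (\<phi> i)\<close>; if \<open>i\<close> is odd, the degree is below
  \<open>i\<close>, so it is orthogonal to \<open>\<phi> i\<close>.\<close>

lemma inner_\<eta>:
  "ip (\<eta> i) (\<eta> j) = (if i = j then 1 else 0)"
proof -
  define g where "g i = (if even i then reversed (\<phi> i) else \<phi> i)" for i
  have deg_g: "degree (g i) \<le> i" for i
    using degree_reversed_le[of "\<phi> i"] by (simp add: g_def)
  have red: "ip (\<eta> i) (\<eta> j) = pinner (g i) (monom 1 (i div 2 - j div 2) * g j)" if "j \<le> i" for i j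
    unfolding pinner_def
  proof (rule inner_cong)
    fix \<zeta> :: complex assume \<zeta>: "cmod \<zeta> = 1"
    have "cnj \<zeta> ^ (i div 2) = cnj \<zeta> ^ (i div 2 - j div 2) * cnj \<zeta> ^ (j div 2)"
      using that by (simp add: div_le_mono flip: power_add)
    then have *: "cnj \<zeta> ^ (i div 2) * \<zeta> ^ (j div 2) = cnj \<zeta> ^ (i div 2 - j div 2)"
      using power_mult_cnj_circle[OF \<zeta>, of "j div 2"] by (simp only: mult.assoc mult.commute[of "cnj \<zeta> ^ (j div 2)"] mult_1_right)
    then have "cnj \<zeta> ^ (i div 2) * poly (g i) \<zeta> * (\<zeta> ^ (j div 2) * cnj (poly (g j) \<zeta>)) =
        poly (g i) \<zeta> * (cnj \<zeta> ^ (i div 2 - j div 2) * cnj (poly (g j) \<zeta>))"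
      unfolding *[symmetric] by (simp only: mult_ac)
    then show "\<eta> i \<zeta> * cnj (\<eta> j \<zeta>) =
        poly (g i) \<zeta> * cnj (poly (monom 1 (i div 2 - j div 2) * g j) \<zeta>)"
      by (simp add: \<eta>_def poly_monom flip: g_def)
  qed (intro continuous_intros)+
  have below: "ip (\<eta> i) (\<eta> j) = 0" if "j < i" for i j
  proof (cases "even i")
    case True
    then obtain a where a: "i = 2 * a" by blast
    define e where "e = a - j div 2 - 1"
    have "j div 2 < a"
      using that a by simp
    then have e: "i div 2 - j div 2 = Suc e"
      by (simp add: a e_def)
    have "j < 2 * (j div 2) + 2"
      by simp
    then have "e + j < i"
      using \<open>j div 2 < a\<close> unfolding a e_def by linarith
    then have "degree (monom 1 e * g j) < i"
      using degree_mult_le[of "monom 1 e" "g j"] degree_monom_le[of "1::complex" e] deg_g[of j] by linarith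
    then have "pinner (reversed (\<phi> i)) (pCons 0 (monom 1 e * g j)) = 0"
      by (rule pinner_reversed_\<phi>_pCons)
    moreover have "monom 1 (Suc e) * g j = pCons 0 (monom 1 e * g j)"
      by (simp add: monom_Suc)
    ultimately show ?thesis
      using True that red[of j i] by (simp add: e g_def[of i])
  next
    case False
    then obtain a where a: "i = 2 * a + 1" by (meson oddE)
    have "j \<noteq> 2 * (j div 2) + 1 \<or> j div 2 < a"
      using that a by linarith
    moreover have "j < 2 * (j div 2) + 2" "j div 2 \<le> a"
      using that a by simp_all
    ultimately have "i div 2 - j div 2 + j < i"
      unfolding a by simp linarith
    then have "degree (monom 1 (i div 2 - j div 2) * g j) < i"
      using degree_mult_le[of "monom 1 (i div 2 - j div 2)" "g j"]
        degree_monom_le[of "1::complex" "i div 2 - j div 2"] deg_g[of j] by linarith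
    then show ?thesis
      using False that red[of j i] by (simp add: g_def[of i] pinner_\<phi>_lower)
  qed
  show ?thesis
  proof (cases i j rule: linorder_cases)
    case less
    then show ?thesis
      using below[OF less] by (subst L2_inner_cnj) simp
  next
    case equal
    have "monom 1 0 * g i = g i"
      by (simp add: monom_0)
    then have "ip (\<eta> i) (\<eta> i) = pinner (g i) (g i)"
      using red[OF order_refl, of i] by simp
    then show ?thesis
      using equal by (simp add: g_def)
  next
    case greater
    then show ?thesis
      using below by simp
  qed
qed

lemma inner_\<xi>: "ip (\<xi> i) (\<xi> j) = (if i = j then 1 else 0)"
proof -
  have "ip (\<xi> i) (\<xi> j) = ip (\<eta> j) (\<eta> i)"
    by (rule inner_cong) (auto intro: continuous_intros simp: \<xi>_eq_cnj_\<eta>)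
  then show ?thesis
    by (simp add: inner_\<eta>)
qed

lemma szego_up:
  "\<zeta> * poly (\<phi> n) \<zeta> =
    cnj (\<alpha> n) * poly (reversed (\<phi> n)) \<zeta> + complex_of_real (rho (\<alpha> n)) * poly (\<phi> (Suc n)) \<zeta>"
  using arg_cong[OF szego[of n], of "\<lambda>f. poly f \<zeta>"] by (simp add: algebra_simps)

text \<open>
  The conjugate of the recursion, with \<open>\<zeta> \<phi>\<^sub>n\<close> eliminated by means of the recursion itself.
\<close>
lemma szego_reversed:
  assumes "cmod \<zeta> = 1"
  shows "poly (reversed (\<phi> (Suc n))) \<zeta> =
    complex_of_real (rho (\<alpha> n)) * poly (reversed (\<phi> n)) \<zeta> - \<alpha> n * poly (\<phi> (Suc n)) \<zeta>"
proof -
  define r where "r = complex_of_real (rho (\<alpha> n))"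
  define P Q S T where "P = poly (\<phi> n) \<zeta>" and "Q = poly (\<phi> (Suc n)) \<zeta>"
    and "S = poly (reversed (\<phi> n)) \<zeta>" and "T = poly (reversed (\<phi> (Suc n))) \<zeta>"
  have r: "r \<noteq> 0" "r * r = 1 - \<alpha> n * cnj (\<alpha> n)" "cnj r = r"
    using rho_pos[OF \<alpha>_less_1[of n]] rho_sq[OF \<alpha>_less_1[of n]] by (simp_all add: r_def)
  have up: "\<zeta> * P = cnj (\<alpha> n) * S + r * Q"
    unfolding P_def Q_def S_def r_def by (rule szego_up)
  have S: "S = \<zeta> ^ n * cnj P" and T: "T = \<zeta> ^ Suc n * cnj Q"
    using assms by (simp_all add: S_def T_def P_def Q_def poly_reversed_circle)
  have unit: "\<zeta> ^ n * cnj \<zeta> ^ n = 1" "\<zeta> * cnj \<zeta> = 1"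
    using assms power_mult_cnj_circle cnj_mult_circle by blast+
  have "r * T = \<zeta> ^ Suc n * cnj (r * Q)"
    by (simp add: T r(3))
  also have "r * Q = \<zeta> * P - cnj (\<alpha> n) * (\<zeta> ^ n * cnj P)"
    using up unfolding S by simp
  also have "\<zeta> ^ Suc n * cnj (\<zeta> * P - cnj (\<alpha> n) * (\<zeta> ^ n * cnj P)) =
      (\<zeta> * cnj \<zeta>) * (\<zeta> ^ n * cnj P) - \<alpha> n * \<zeta> * P * (\<zeta> ^ n * cnj \<zeta> ^ n)"
    by (simp add: algebra_simps)
  also have "\<dots> = S - \<alpha> n * (\<zeta> * P)"
    by (simp add: unit S)
  also have "\<dots> = r * (r * S - \<alpha> n * Q)"
    unfolding up using r(2) by algebra
  finally have "T = r * S - \<alpha> n * Q"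
    using r(1) by simp
  then show ?thesis
    by (simp add: T_def r_def S_def Q_def)
qed

text \<open>Columns \<open>2 * m\<close> and \<open>2 * m + 1\<close> are the recursion and its
  reversed form with parameter \<open>\<alpha> (2 * m)\<close>, both multiplied by
  \<open>cnj \<zeta> ^ m\<close>.\<close>

lemma expansion_L: "expansion 1 (L_mat \<alpha>) (\<lambda>j \<zeta>. \<zeta> * \<xi> j \<zeta>) \<eta>"
  unfolding expansion_def
proof (intro conjI banded_L_mat allI impI)
  fix j N \<zeta> assume \<zeta>: "cmod \<zeta> = 1" and N: "j + 1 \<le> (N::nat)"
  define m where "m = j div 2"
  have "(\<Sum>i\<le>N. cnj (L_mat \<alpha> i j) * \<eta> i \<zeta>) = (\<Sum>i\<in>{2 * m, 2 * m + 1}. cnj (L_mat \<alpha> i j) * \<eta> i \<zeta>)"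
  proof (rule sum.mono_neutral_right)
    show "{2 * m, 2 * m + 1} \<subseteq> {..N}"
      using N by (auto simp: m_def)
    show "\<forall>i\<in>{..N} - {2 * m, 2 * m + 1}. cnj (L_mat \<alpha> i j) * \<eta> i \<zeta> = 0"
      by (auto simp: L_mat_def block_sum_def m_def)
  qed simp
  also have "\<dots> = \<zeta> * \<xi> j \<zeta>"
  proof (cases "even j")
    case True
    then have j: "j = 2 * m"
      by (simp add: m_def)
    have "\<zeta> * \<xi> j \<zeta> = cnj \<zeta> ^ m * (\<zeta> * poly (\<phi> j) \<zeta>)"
      by (simp add: j \<xi>_def)
    then show ?thesis
      unfolding szego_up by (simp add: j L_mat_eq \<eta>_def) (simp only: distrib_left mult_ac)
  next
    case False
    then have j: "j = Suc (2 * m)"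
      by (simp add: m_def)
    have "\<zeta> * \<xi> j \<zeta> = (\<zeta> * cnj \<zeta>) * (cnj \<zeta> ^ m * poly (reversed (\<phi> j)) \<zeta>)"
      by (simp add: j \<xi>_def)
    then show ?thesis
      using szego_reversed[OF \<zeta>, of "2 * m"] cnj_mult_circle[OF \<zeta>]
      by (simp add: j L_mat_eq \<eta>_def) (simp only: right_diff_distrib mult_ac)
  qed
  finally show "\<zeta> * \<xi> j \<zeta> = (\<Sum>i\<le>N. cnj (L_mat \<alpha> i j) * \<eta> i \<zeta>)"
    by simp
qed

text \<open>\<open>\<phi> 0\<close> is a real constant, hence its own reversal; this accounts for
  the 1 by 1 block of \<open>M\<close>.\<close>

lemma \<eta>_0_eq_\<xi>_0: "\<eta> 0 = \<xi> 0"
proof -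
  obtain c where c: "\<phi> 0 = [:complex_of_real c:]"
    unfolding \<phi>_eq_szego_poly szego_poly.simps by blast
  show ?thesis
    by (auto simp: \<eta>_def \<xi>_def c reversed_def map_poly_pCons)
qed

text \<open>After column 0, the same two recursions with odd parameter: columns
  \<open>2 * m + 1\<close> and \<open>2 * m + 2\<close> use \<open>\<alpha> (2 * m + 1)\<close>,
  multiplied by \<open>cnj \<zeta> ^ Suc m\<close>.\<close>

lemma expansion_M: "expansion 1 (M_mat \<alpha>) \<eta> \<xi>"
  unfolding expansion_def
proof (intro conjI banded_M_mat allI impI)
  fix j N \<zeta> assume \<zeta>: "cmod \<zeta> = 1" and N: "j + 1 \<le> (N::nat)"
  show "\<eta> j \<zeta> = (\<Sum>i\<le>N. cnj (M_mat \<alpha> i j) * \<xi> i \<zeta>)"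
  proof (cases "j = 0")
    case True
    have "(\<Sum>i\<le>N. cnj (M_mat \<alpha> i j) * \<xi> i \<zeta>) = (\<Sum>i\<in>{0}. cnj (M_mat \<alpha> i j) * \<xi> i \<zeta>)"
      by (rule sum.mono_neutral_right) (auto simp: True M_mat_eq)
    then show ?thesis
      by (simp add: True M_mat_eq \<eta>_0_eq_\<xi>_0)
  next
    case False
    define m where "m = (j - 1) div 2"
    have "(\<Sum>i\<le>N. cnj (M_mat \<alpha> i j) * \<xi> i \<zeta>) =
        (\<Sum>i\<in>{Suc (2 * m), Suc (Suc (2 * m))}. cnj (M_mat \<alpha> i j) * \<xi> i \<zeta>)"
    proof (rule sum.mono_neutral_right)
      show "{Suc (2 * m), Suc (Suc (2 * m))} \<subseteq> {..N}"
        using N False by (auto simp: m_def)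
      show "\<forall>i\<in>{..N} - {Suc (2 * m), Suc (Suc (2 * m))}. cnj (M_mat \<alpha> i j) * \<xi> i \<zeta> = 0"
      proof
        fix i assume "i \<in> {..N} - {Suc (2 * m), Suc (Suc (2 * m))}"
        then show "cnj (M_mat \<alpha> i j) * \<xi> i \<zeta> = 0"
          using False by (cases i; cases j) (auto simp: M_mat_def block_sum_def m_def)
      qed
    qed simp
    also have "\<dots> = \<eta> j \<zeta>"
    proof (cases "odd j")
      case True
      then have j: "j = Suc (2 * m)"
        by (auto simp: m_def elim!: oddE)
      \<comment> \<open>A factor \<open>cnj \<zeta> * \<zeta> = 1\<close> is inserted to produce the
        left-hand side of \<open>szego_up\<close>.\<close>
      have "\<eta> j \<zeta> = (cnj \<zeta> * \<zeta>) * (cnj \<zeta> ^ m * poly (\<phi> j) \<zeta>)"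
        using cnj_mult_circle[OF \<zeta>] by (simp add: j \<eta>_def mult.commute)
      also have "\<dots> = cnj \<zeta> ^ Suc m * (\<zeta> * poly (\<phi> j) \<zeta>)"
        by simp
      finally show ?thesis
        unfolding szego_up by (simp add: j M_mat_eq \<xi>_def) (simp only: distrib_left mult_ac)
    next
      case False
      then have j: "j = Suc (Suc (2 * m))"
        using \<open>j \<noteq> 0\<close> by (auto simp: m_def elim!: evenE)
      show ?thesis
        using szego_reversed[OF \<zeta>, of "Suc (2 * m)"]
        by (simp add: j M_mat_eq \<eta>_def \<xi>_def) (simp only: right_diff_distrib mult_ac)
    qed
    finally show ?thesis
      by simp
  qed
qed

section \<open>Matrix entries of words as inner products\<close>

lemma inner_expansion:
  assumes "expansion w A u v"
    and "\<And>i j. ip (v i) (v j) = (if i = j then 1 else 0)"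
    and "\<And>i. continuous_on UNIV (v i)" "\<And>i. continuous_on UNIV (u i)"
  shows "ip (v i) (u j) = A i j"
proof -
  define N where "N = i + j + w"
  have "u j \<zeta> = (\<Sum>l\<le>N. cnj (A l j) * v l \<zeta>)" if "cmod \<zeta> = 1" for \<zeta>
    using assms(1) that by (auto simp: expansion_def N_def)
  then have "ip (v i) (u j) = ip (v i) (\<lambda>\<zeta>. \<Sum>l\<le>N. cnj (A l j) * v l \<zeta>)"
    by (intro inner_cong continuous_intros assms(3,4)) simp
  \<comment> \<open>The conjugate in \<open>expansion\<close> is undone by the conjugate-linear
    second argument.\<close>
  also have "\<dots> = (\<Sum>l\<le>N. A l j * ip (v i) (v l))"
    using assms(3) by (subst inner_sum_right) (auto intro!: continuous_intros simp: inner_scale_right)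
  also have "\<dots> = (\<Sum>l\<in>{i}. A l j * ip (v i) (v l))"
    by (rule sum.mono_neutral_right) (auto simp: assms(2) N_def)
  also have "\<dots> = A i j"
    by (simp add: assms(2))
  finally show ?thesis .
qed

text \<open>\<open>M\<close> expands \<zeta> \<eta> in \<zeta> \<xi>, and \<open>L\<close> expands
  \<zeta> \<xi> in \<eta>.\<close>

lemma expansion_C: "expansion 2 (C_mat \<alpha>) (\<lambda>j \<zeta>. \<zeta> * \<eta> j \<zeta>) \<eta>"
  using expansion_mmult[OF expansion_L, of 1 "M_mat \<alpha>" "\<lambda>j \<zeta>. \<zeta> * \<eta> j \<zeta>"]
    expansion_mult_power[OF expansion_M, of 1]
  by (simp add: C_mat_def numeral_2_eq_2)

text \<open>One factor \<zeta> is spent on passing from \<xi> to \<eta> through \<open>L\<close>;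
  the other \<open>k\<close> give the power of \<open>C\<close>. In \<open>inner_odd_word\<close>
  the passage through \<open>M\<close> costs no factor.\<close>

lemma inner_even_word: "ip (\<eta> i) (\<lambda>\<zeta>. \<zeta> ^ Suc k * \<xi> j \<zeta>) = even_word \<alpha> k i j"
proof -
  have "expansion (2 * k + 1) (even_word \<alpha> k) (\<lambda>j \<zeta>. \<zeta> ^ k * (\<zeta> * \<xi> j \<zeta>)) \<eta>"
    unfolding even_word_def
    by (intro expansion_mmult[OF expansion_mpow[OF expansion_C]] expansion_mult_power expansion_L)
  then have "ip (\<eta> i) (\<lambda>\<zeta>. \<zeta> ^ k * (\<zeta> * \<xi> j \<zeta>)) = even_word \<alpha> k i j"
    by (rule inner_expansion) (intro inner_\<eta> continuous_intros)+
  then show ?thesis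
    by (simp add: mult_ac)
qed

lemma inner_odd_word: "ip (\<xi> i) (\<lambda>\<zeta>. \<zeta> ^ k * \<eta> j \<zeta>) = odd_word \<alpha> k i j"
proof -
  have "expansion (1 + 2 * k) (odd_word \<alpha> k) (\<lambda>j \<zeta>. \<zeta> ^ k * \<eta> j \<zeta>) \<xi>"
    unfolding odd_word_def by (rule expansion_mmult[OF expansion_M expansion_mpow[OF expansion_C]])
  then show ?thesis
    by (rule inner_expansion) (intro inner_\<xi> continuous_intros)+
qed

lemma F_eq: "F \<mu> k n = ip (poly (reversed (\<phi> n))) (\<lambda>\<zeta>. \<zeta> ^ k * poly (\<phi> n) \<zeta>)"
  by (simp add: F_def \<phi>_def)

lemma F_even: "even n \<Longrightarrow> F \<mu> (Suc k) n = even_word \<alpha> k n n"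
proof -
  assume "even n"
  then obtain m where n: "n = 2 * m" by blast
  have "F \<mu> (Suc k) n = ip (\<eta> n) (\<lambda>\<zeta>. \<zeta> ^ Suc k * \<xi> n \<zeta>)"
    unfolding F_eq
  proof (rule inner_cong)
    fix \<zeta> :: complex assume "cmod \<zeta> = 1"
    then have "cnj \<zeta> ^ m * \<zeta> ^ m = 1"
      by (metis power_mult_cnj_circle mult.commute)
    then show "poly (reversed (\<phi> n)) \<zeta> * cnj (\<zeta> ^ Suc k * poly (\<phi> n) \<zeta>) = \<eta> n \<zeta> * cnj (\<zeta> ^ Suc k * \<xi> n \<zeta>)"
      by (simp add: \<eta>_def \<xi>_def n)
  qed (intro continuous_intros)+
  then show ?thesis
    by (simp only: inner_even_word)
qed

text \<open>For odd \<open>n\<close>, \<open>\<xi> n\<close> has one factor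
  \<open>cnj \<zeta>\<close> more than \<open>\<eta> n\<close>, which absorbs one of the
  \<open>Suc k\<close> powers; for even \<open>n\<close> the two factors are equal and
  cancel.\<close>

lemma F_odd: "odd n \<Longrightarrow> F \<mu> (Suc k) n = odd_word \<alpha> k n n"
proof -
  assume "odd n"
  then obtain m where n: "n = Suc (2 * m)" by (metis oddE Suc_eq_plus1)
  have "F \<mu> (Suc k) n = ip (\<xi> n) (\<lambda>\<zeta>. \<zeta> ^ k * \<eta> n \<zeta>)"
    unfolding F_eq
  proof (rule inner_cong)
    fix \<zeta> :: complex assume "cmod \<zeta> = 1"
    then have "cnj \<zeta> ^ m * \<zeta> ^ m = 1"
      by (metis power_mult_cnj_circle mult.commute)
    then show "poly (reversed (\<phi> n)) \<zeta> * cnj (\<zeta> ^ Suc k * poly (\<phi> n) \<zeta>) = \<xi> n \<zeta> * cnj (\<zeta> ^ k * \<eta> n \<zeta>)"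
      by (simp add: \<eta>_def \<xi>_def n)
  qed (intro continuous_intros)+
  then show ?thesis
    by (simp only: inner_odd_word)
qed


subsection \<open>Square summability\<close>

text \<open>Cauchy-Schwarz for unit vectors, from the squared norm of \<open>f\<close> minus its
  projection onto \<open>g\<close>.\<close>

lemma cmod_pinner_le_1:
  assumes "pinner f f = 1" "pinner g g = 1"
  shows "cmod (pinner f g) \<le> 1"
proof -
  define c where "c = pinner f g"
  define h where "h = f - smult c g"
  have "pinner h h = 1 - c * cnj c"
    using assms pinner_cnj[of g f] by (simp add: h_def c_def pinner_linear algebra_simps)
  then have "Re (pinner h h) = 1 - (cmod c)\<^sup>2"
    by (simp flip: complex_norm_square)
  moreover have "Re (pinner h h) \<ge> 0"
    using Re_pinner_self_pos[of h] by (cases "h = 0") auto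
  ultimately show ?thesis
    by (simp add: c_def abs_square_le_1)
qed

lemma pinner_monom_mult_monom_mult [simp]: "pinner (monom 1 k * f) (monom 1 k * g) = pinner f g"
  by (induction k) (simp_all add: monom_0 monom_Suc flip: one_pCons)

text \<open>The shift \<open>j\<close> is there for the induction: the recursion trades one factor
  \<zeta> in front of \<open>\<phi> (n + j)\<close> for a passage to
  \<open>\<phi> (n + Suc j)\<close>, up to a remainder of modulus at most
  \<open>cmod (\<alpha> (n + j))\<close>. By \<open>k + j \<ge> 1\<close> the base case pairs
  \<open>reversed (\<phi> n)\<close> with a later orthonormal polynomial, which gives 0.\<close>

lemma summable_shifted_inner:
  assumes "summable (\<lambda>n. (cmod (\<alpha> n))\<^sup>2)" "k + j \<ge> 1"
  shows "summable (\<lambda>n. (cmod (pinner (reversed (\<phi> n)) (monom 1 k * \<phi> (n + j))))\<^sup>2)"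
  using assms(2)
proof (induction k arbitrary: j)
  case 0
  then show ?case
    by (simp add: pinner_\<phi>_reversed_lower monom_0 flip: one_pCons)
next
  case (Suc k)
  define G where "G n = pinner (reversed (\<phi> n)) (monom 1 k * \<phi> (n + Suc j))" for n
  have "summable (\<lambda>n. (cmod (G n))\<^sup>2)"
    unfolding G_def by (rule Suc.IH) simp
  moreover have "summable (\<lambda>n. (cmod (\<alpha> (n + j)))\<^sup>2)"
    using assms(1) by (subst summable_iff_shift)
  ultimately have sum: "summable (\<lambda>n. 2 * (cmod (\<alpha> (n + j)))\<^sup>2 + 2 * (cmod (G n))\<^sup>2)"
    by (intro summable_add summable_mult)
  have bound: "(cmod (pinner (reversed (\<phi> n)) (monom 1 (Suc k) * \<phi> (n + j))))\<^sup>2 \<le>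
      2 * (cmod (\<alpha> (n + j)))\<^sup>2 + 2 * (cmod (G n))\<^sup>2" for n
  proof -
    define r where "r = rho (\<alpha> (n + j))"
    define H where "H = pinner (reversed (\<phi> n)) (monom 1 k * reversed (\<phi> (n + j)))"
    have "pCons 0 (\<phi> (n + j)) = smult (complex_of_real r) (\<phi> (n + Suc j)) +
        smult (cnj (\<alpha> (n + j))) (reversed (\<phi> (n + j)))"
      using szego[of "n + j"] by (simp add: r_def)
    moreover have "monom 1 (Suc k) * \<phi> (n + j) = monom 1 k * pCons 0 (\<phi> (n + j))"
      by (simp add: monom_Suc)
    ultimately have eq: "pinner (reversed (\<phi> n)) (monom 1 (Suc k) * \<phi> (n + j)) =
        complex_of_real r * G n + \<alpha> (n + j) * H"
      by (simp add: distrib_left pinner_linear G_def H_def)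
    have "cmod H \<le> 1"
      unfolding H_def by (rule cmod_pinner_le_1) simp_all
    then have "cmod (\<alpha> (n + j) * H) \<le> cmod (\<alpha> (n + j))"
      by (simp add: norm_mult mult_left_le)
    moreover have "0 \<le> r" "r \<le> 1"
      using rho_pos[OF \<alpha>_less_1[of "n + j"]] by (simp_all add: r_def) (simp add: rho_def)
    then have "cmod (complex_of_real r * G n) \<le> cmod (G n)"
      by (simp add: norm_mult mult_left_le_one_le)
    ultimately have "cmod (pinner (reversed (\<phi> n)) (monom 1 (Suc k) * \<phi> (n + j))) \<le>
        cmod (\<alpha> (n + j)) + cmod (G n)"
      unfolding eq by (intro order.trans[OF norm_triangle_ineq]) linarith
    then have "(cmod (pinner (reversed (\<phi> n)) (monom 1 (Suc k) * \<phi> (n + j))))\<^sup>2 \<le>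
        (cmod (\<alpha> (n + j)) + cmod (G n))\<^sup>2"
      by (intro power_mono) auto
    also have "\<dots> \<le> 2 * (cmod (\<alpha> (n + j)))\<^sup>2 + 2 * (cmod (G n))\<^sup>2"
      using sum_squares_bound[of "cmod (\<alpha> (n + j))" "cmod (G n)"] by (simp add: power2_sum)
    finally show ?thesis .
  qed
  show ?case
    by (rule summable_comparison_test'[OF sum]) (use bound in simp)
qed

lemma summable_F:
  assumes "summable (\<lambda>n. (cmod (\<alpha> n))\<^sup>2)" "k \<ge> 1"
  shows "summable (\<lambda>n. (cmod (F \<mu> k n))\<^sup>2)"
proof -
  have "F \<mu> k n = pinner (reversed (\<phi> n)) (monom 1 k * \<phi> (n + 0))" for n
    by (simp add: F_eq pinner_def poly_mult[abs_def] poly_monom)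
  then show ?thesis
    using summable_shifted_inner[OF assms(1), of k 0] assms(2) by simp
qed

text \<open>Compare coefficients of degree \<open>Suc n\<close> in the recursion:
  \<open>reversed (\<phi> n)\<close> contributes nothing there.\<close>

lemma lead_coeff_\<phi>:
  "cmod (lead_coeff (\<phi> n)) * (\<Prod>i<n. rho (\<alpha> i)) = cmod (lead_coeff (\<phi> 0))"
proof (induction n)
  case (Suc n)
  have "complex_of_real (rho (\<alpha> n)) * lead_coeff (\<phi> (Suc n)) = lead_coeff (\<phi> n)"
    using arg_cong[OF szego[of n], of "\<lambda>f. coeff f (Suc n)"] degree_reversed_le[of "\<phi> n"]
    by (simp add: coeff_eq_0)
  then have "cmod (lead_coeff (\<phi> n)) = rho (\<alpha> n) * cmod (lead_coeff (\<phi> (Suc n)))"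
    using rho_pos[OF \<alpha>_less_1[of n]] by (metis norm_mult norm_of_real abs_of_pos)
  then show ?case
    using Suc by (simp add: mult_ac)
qed simp

text \<open>Since \<open>\<phi> n\<close> has norm one, its leading coefficient is bounded; by
  \<open>lead_coeff_\<phi>\<close> the squared product of the \<open>rho (\<alpha> i)\<close> then
  stays above \<open>d\<close>. The estimate 1 - x \<le> exp (-x) turns this into the bound
  \<open>- ln d\<close> for the partial sums.\<close>

lemma summable_\<alpha>:
  assumes "c > 0" "\<And>f. Re (pinner f f) \<ge> c * (cmod (lead_coeff f))\<^sup>2"
  shows "summable (\<lambda>n. (cmod (\<alpha> n))\<^sup>2)"
proof -
  define \<kappa> where "\<kappa> = cmod (lead_coeff (\<phi> 0))"
  have "\<kappa> > 0"
    using ortho_polyD(2)[OF ortho_poly_\<phi>, of 0] unfolding \<kappa>_def zero_less_norm_iff leading_coeff_0_iff .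
  define d where "d = c * \<kappa>\<^sup>2"
  have "d > 0"
    using assms(1) \<open>\<kappa> > 0\<close> by (simp add: d_def)
  have "(\<Sum>i<n. (cmod (\<alpha> i))\<^sup>2) \<le> - ln d" for n
  proof -
    have "c * (cmod (lead_coeff (\<phi> n)))\<^sup>2 \<le> 1"
      using assms(2)[of "\<phi> n"] by simp
    then have "c * (cmod (lead_coeff (\<phi> n)))\<^sup>2 * (\<Prod>i<n. rho (\<alpha> i))\<^sup>2 \<le> (\<Prod>i<n. rho (\<alpha> i))\<^sup>2"
      by (simp add: mult_left_le_one_le assms(1) less_imp_le)
    then have "d \<le> (\<Prod>i<n. rho (\<alpha> i))\<^sup>2"
      unfolding d_def \<kappa>_def lead_coeff_\<phi>[of n, symmetric] by (simp add: power_mult_distrib mult.assoc)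
    also have "\<dots> = (\<Prod>i<n. 1 - (cmod (\<alpha> i))\<^sup>2)"
      unfolding prod_power_distrib using \<alpha>_less_1
      by (intro prod.cong) (simp_all add: rho_def power_le_one_iff less_imp_le)
    also have "\<dots> \<le> (\<Prod>i<n. exp (- (cmod (\<alpha> i))\<^sup>2))"
    proof (rule prod_mono)
      fix i
      show "0 \<le> 1 - (cmod (\<alpha> i))\<^sup>2 \<and> 1 - (cmod (\<alpha> i))\<^sup>2 \<le> exp (- (cmod (\<alpha> i))\<^sup>2)"
        using \<alpha>_less_1[of i] exp_ge_add_one_self[of "- (cmod (\<alpha> i))\<^sup>2"]
        by (simp add: abs_square_le_1 less_imp_le)
    qed
    also have "\<dots> = exp (- (\<Sum>i<n. (cmod (\<alpha> i))\<^sup>2))"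
      by (simp only: exp_sum finite_lessThan flip: sum_negf)
    finally have "ln d \<le> ln (exp (- (\<Sum>i<n. (cmod (\<alpha> i))\<^sup>2)))"
      using \<open>d > 0\<close> by (subst ln_le_cancel_iff) auto
    then show ?thesis
      by simp
  qed
  then show ?thesis
    by (intro summableI_nonneg_bounded[where x = "- ln d"]) auto
qed

end


section \<open>The measure attached to a homogeneous polynomial\<close>

lemma integral_circle_measure:
  fixes f :: "complex \<Rightarrow> complex"
  assumes [measurable]: "f \<in> borel_measurable borel"
  shows "(\<integral>\<zeta>. f \<zeta> \<partial>circle_measure) =
    (\<integral>t. indicator {0..2 * pi} t *\<^sub>R f (cis t) \<partial>lborel) / complex_of_real (2 * pi)"
proof -
  have cis [measurable]: "cis \<in> borel_measurable borel"
    by (intro borel_measurable_continuous_onI continuous_intros)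
  have eq: "uniform_measure lborel {0..<2 * pi} =
      density lborel (\<lambda>t. ennreal (indicator {0..<2 * pi} t / (2 * pi)))"
    unfolding uniform_measure_def
    using divide_ennreal[of 1 "2 * pi"] by (intro density_cong) (auto simp: indicator_def)
  have "(\<integral>\<zeta>. f \<zeta> \<partial>circle_measure) = (\<integral>t. f (cis t) \<partial>uniform_measure lborel {0..<2 * pi})"
    unfolding circle_measure_def by (rule integral_distr) auto
  also have "\<dots> = (\<integral>t. (indicator {0..<2 * pi} t / (2 * pi)) *\<^sub>R f (cis t) \<partial>lborel)"
    unfolding eq by (rule integral_density) auto
  \<comment> \<open>The endpoint is a null set; the closed interval suits the fundamental theorem of
    calculus.\<close>
  also have "\<dots> = (\<integral>t. indicator {0..2 * pi} t *\<^sub>R f (cis t) / complex_of_real (2 * pi) \<partial>lborel)"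
  proof (rule integral_cong_AE)
    show "AE t in lborel. (indicator {0..<2 * pi} t / (2 * pi)) *\<^sub>R f (cis t) =
        indicator {0..2 * pi} t *\<^sub>R f (cis t) / complex_of_real (2 * pi)"
      using AE_lborel_singleton[of "2 * pi"]
      by eventually_elim (auto simp: indicator_def scaleR_conv_of_real)
  qed measurable
  also have "\<dots> = (\<integral>t. indicator {0..2 * pi} t *\<^sub>R f (cis t) \<partial>lborel) / complex_of_real (2 * pi)"
    by (rule integral_divide_zero)
  finally show ?thesis .
qed

lemma circle_measure_space_circle_measure: "circle_measure_space circle_measure"
proof -
  have cis [measurable]: "cis \<in> borel_measurable borel"
    by (intro borel_measurable_continuous_onI continuous_intros)
  interpret finite_measure circle_measure
    unfolding circle_measure_def
    by (rule finite_measureI) (simp add: emeasure_distr ennreal_divide_eq_top_iff)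
  show ?thesis
  proof
  show "sets circle_measure = sets borel"
    by (simp add: circle_measure_def)
  show "AE \<zeta> in circle_measure. cmod \<zeta> = 1"
    unfolding circle_measure_def by (subst AE_distr_iff) auto
  qed
qed

interpretation circle: circle_measure_space circle_measure
  by (rule circle_measure_space_circle_measure)

lemma circle_pinner_monom:
  "circle.pinner (monom 1 i) (monom 1 j) = (if i = j then 1 else 0)"
proof -
  define a where "a = real i - real j"
  have cis_power: "cis t ^ i * cnj (cis t) ^ j = cis (a * t)" for t
    by (simp add: a_def Complex.DeMoivre cis_cnj cis_mult algebra_simps)
  have "circle.pinner (monom 1 i) (monom 1 j) =
      (\<integral>t. indicator {0..2 * pi} t *\<^sub>R cis (a * t) \<partial>lborel) / complex_of_real (2 * pi)"
    unfolding circle.pinner_def L2_inner_def poly_monom mult_1_left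
    by (subst integral_circle_measure)
      (auto intro!: borel_measurable_continuous_onI continuous_intros simp: cis_power)
  also have "\<dots> = (if i = j then 1 else 0)"
  proof (cases "i = j")
    case True
    then have "(\<integral>t. indicator {0..2 * pi} t *\<^sub>R cis (a * t) \<partial>lborel) = (2 * pi) *\<^sub>R (1 :: complex)"
      by (simp add: a_def)
    then show ?thesis
      using True by (simp add: scaleR_conv_of_real)
  next
    case False
    then have a: "a \<noteq> 0"
      by (simp add: a_def)
    have "((\<lambda>t. cis (a * t) / (\<i> * complex_of_real a)) has_vector_derivative cis (a * t)) (at t within A)" for t A
    proof -
      let ?f = "\<lambda>z. exp (\<i> * complex_of_real a * z) / (\<i> * complex_of_real a)"
      have "(?f has_field_derivative exp (\<i> * complex_of_real a * complex_of_real t)) (at (complex_of_real t))"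
        using a by (auto intro!: derivative_eq_intros)
      then have "((\<lambda>t. ?f (complex_of_real t)) has_vector_derivative
          exp (\<i> * complex_of_real a * complex_of_real t)) (at t within A)"
        by (rule has_vector_derivative_real_field)
      then show ?thesis
        by (simp add: cis_conv_exp mult.assoc)
    qed
    then have "(\<integral>t. indicator {0..2 * pi} t *\<^sub>R cis (a * t) \<partial>lborel) =
        cis (a * (2 * pi)) / (\<i> * complex_of_real a) - cis (a * 0) / (\<i> * complex_of_real a)"
      by (intro integral_FTC_atLeastAtMost) (auto intro!: continuous_intros)
    moreover have "cis (a * (2 * pi)) = 1"
      by (auto simp: a_def mult.commute[of _ "2 * pi"] intro!: cis_multiple_2pi)
    ultimately show ?thesis
      using False by simp
  qed
  finally show ?thesis .
qed

text \<open>Parseval for polynomials; it matches Haar measure with the coefficient inner product of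
  the Hardy space.\<close>

lemma circle_pinner_eq_sum:
  assumes "degree f \<le> N" "degree g \<le> N"
  shows "circle.pinner f g = (\<Sum>i\<le>N. coeff f i * cnj (coeff g i))"
proof -
  have expand: "h = (\<Sum>i\<le>N. smult (coeff h i) (monom 1 i))" if "degree h \<le> N" for h :: "complex poly"
    using poly_as_sum_of_monoms'[OF that] by (simp add: smult_monom)
  have "circle.pinner f g =
      circle.pinner (\<Sum>i\<le>N. smult (coeff f i) (monom 1 i)) (\<Sum>j\<le>N. smult (coeff g j) (monom 1 j))"
    by (rule arg_cong2[OF expand[OF assms(1)] expand[OF assms(2)]])
  also have "\<dots> = (\<Sum>i\<le>N. \<Sum>j\<le>N. coeff f i * (cnj (coeff g j) * (if i = j then 1 else 0)))"
    unfolding circle.pinner_sum_left circle.pinner_smult_left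
    unfolding circle.pinner_sum_right circle.pinner_smult_right circle_pinner_monom sum_distrib_left ..
  also have "\<dots> = (\<Sum>i\<le>N. coeff f i * cnj (coeff g i))"
  proof (rule sum.cong[OF refl])
    fix i assume "i \<in> {..N}"
    then have "(\<Sum>j\<le>N. coeff f i * (cnj (coeff g j) * (if i = j then 1 else 0))) =
        (\<Sum>j\<in>{i}. coeff f i * (cnj (coeff g j) * (if i = j then 1 else 0)))"
      by (intro sum.mono_neutral_right) auto
    then show "(\<Sum>j\<le>N. coeff f i * (cnj (coeff g j) * (if i = j then 1 else 0))) =
        coeff f i * cnj (coeff g i)"
      by simp
  qed
  finally show ?thesis .
qed

lemma circle_pinner_self:
  "circle.pinner f f = complex_of_real (\<Sum>i\<le>degree f. (cmod (coeff f i))\<^sup>2)"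
  by (simp only: circle_pinner_eq_sum[OF order_refl order_refl] of_real_sum complex_norm_square)

text \<open>One term of the Parseval sum is kept. The bound is later applied to products
  \<open>q * f\<close>, whose leading coefficients multiply.\<close>

lemma circle_pinner_self_ge: "(cmod (lead_coeff f))\<^sup>2 \<le> Re (circle.pinner f f)"
  unfolding circle_pinner_self Re_complex_of_real by (rule member_le_sum) auto

lemma Re_circle_pinner_pos: "q \<noteq> 0 \<Longrightarrow> Re (circle.pinner q q) > 0"
  using circle_pinner_self_ge[of q] by (smt (verit) leading_coeff_0_iff zero_less_norm_iff zero_less_power)

lemma circle_integral_norm_sq: "(\<integral>\<zeta>. (cmod (poly f \<zeta>))\<^sup>2 \<partial>circle_measure) = Re (circle.pinner f f)"
  by (simp add: circle.pinner_self)

section \<open>The circle measure weighted by a polynomial\<close>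

definition weighted_circle_measure :: "complex poly \<Rightarrow> complex measure" where
  "weighted_circle_measure q = density circle_measure
     (\<lambda>\<zeta>. ennreal ((cmod (poly q \<zeta>))\<^sup>2 / Re (circle.pinner q q)))"

lemma poly_measure_eq: "poly_measure p = weighted_circle_measure (dehomogenize p)"
  by (simp only: poly_measure_def weighted_circle_measure_def circle_integral_norm_sq)

text \<open>The density |q|^2 is distributed over the two arguments, which reduces inner products to
  Haar measure.\<close>

lemma L2_inner_weighted:
  assumes "q \<noteq> 0"
  shows "L2_inner (weighted_circle_measure q) (poly f) (poly g) =
    circle.pinner (q * f) (q * g) / complex_of_real (Re (circle.pinner q q))"
proof -
  have meas: "(\<lambda>\<zeta>. h \<zeta>) \<in> borel_measurable circle_measure" if "continuous_on UNIV h"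
    for h :: "complex \<Rightarrow> 'a::topological_space"
    using borel_measurable_continuous_onI[OF that] measurable_cong_sets[OF circle.sets_eq_borel refl] by blast
  have "L2_inner (weighted_circle_measure q) (poly f) (poly g) =
      (\<integral>\<zeta>. ((cmod (poly q \<zeta>))\<^sup>2 / Re (circle.pinner q q)) *\<^sub>R (poly f \<zeta> * cnj (poly g \<zeta>)) \<partial>circle_measure)"
    unfolding L2_inner_def weighted_circle_measure_def
    using Re_circle_pinner_pos[OF assms] by (intro integral_density meas continuous_intros AE_I2) auto
  also have "\<dots> = (\<integral>\<zeta>. poly (q * f) \<zeta> * cnj (poly (q * g) \<zeta>) / complex_of_real (Re (circle.pinner q q)) \<partial>circle_measure)"
    by (intro Bochner_Integration.integral_cong refl)
      (simp add: scaleR_conv_of_real complex_norm_square del: of_real_power flip: of_real_power)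
  finally show ?thesis
    by (simp add: circle.pinner_def L2_inner_def)
qed

lemma nontrivial_weighted_circle_measure:
  assumes "q \<noteq> 0"
  shows "nontrivial_circle_measure_space (weighted_circle_measure q)"
proof -
  let ?\<mu> = "weighted_circle_measure q"
  define N where "N = Re (circle.pinner q q)"
  have N: "N > 0"
    using Re_circle_pinner_pos[OF assms] by (simp add: N_def)
  have int: "integrable circle_measure (\<lambda>\<zeta>. (cmod (poly q \<zeta>))\<^sup>2 / N)"
  proof -
    have "integrable circle_measure (\<lambda>\<zeta>. Re (complex_of_real ((cmod (poly q \<zeta>))\<^sup>2 / N)))"
      using N by (intro integrable_Re circle.integrable_continuous continuous_intros) auto
    then show ?thesis
      by (simp only: Re_complex_of_real)
  qed
  then have meas: "(\<lambda>\<zeta>. ennreal ((cmod (poly q \<zeta>))\<^sup>2 / N)) \<in> borel_measurable circle_measure"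
    by (intro measurable_compose[OF _ measurable_ennreal] borel_measurable_integrable)
  interpret finite_measure ?\<mu>
  proof (rule finite_measureI)
    have "emeasure ?\<mu> (space ?\<mu>) = (\<integral>\<^sup>+\<zeta>. ennreal ((cmod (poly q \<zeta>))\<^sup>2 / N) \<partial>circle_measure)"
      unfolding weighted_circle_measure_def N_def[symmetric]
      by (subst emeasure_density[OF meas]) (auto intro!: nn_integral_cong)
    also have "\<dots> = ennreal (\<integral>\<zeta>. (cmod (poly q \<zeta>))\<^sup>2 / N \<partial>circle_measure)"
      using N by (intro nn_integral_eq_integral int) auto
    finally show "emeasure ?\<mu> (space ?\<mu>) \<noteq> \<infinity>"
      by simp
  qed
  interpret circle_measure_space ?\<mu>
  proof
    show "sets ?\<mu> = sets borel"
      by (simp add: weighted_circle_measure_def circle.sets_eq_borel)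
    show "AE \<zeta> in ?\<mu>. cmod \<zeta> = 1"
      unfolding weighted_circle_measure_def N_def[symmetric] AE_density[OF meas]
      using circle.AE_circle by (auto elim: eventually_mono)
  qed
  show ?thesis
  proof
    fix f :: "complex poly" assume "f \<noteq> 0"
    show "\<not> (AE \<zeta> in ?\<mu>. poly f \<zeta> = 0)"
    proof
      assume AE: "AE \<zeta> in ?\<mu>. poly f \<zeta> = 0"
      \<comment> \<open>If \<open>f\<close> vanished almost everywhere, \<open>q * f\<close> would
        have norm zero for Haar measure and hence be zero, although both factors are
        nonzero.\<close>
      have "pinner f f = 0"
        unfolding pinner_def L2_inner_def
        by (rule integral_eq_zero_AE) (use AE in \<open>auto elim: eventually_mono\<close>)
      then have "circle.pinner (q * f) (q * f) = 0"
        using N by (simp add: pinner_def L2_inner_weighted[OF assms] flip: N_def)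
      then show False
        using Re_circle_pinner_pos[of "q * f"] assms \<open>f \<noteq> 0\<close> by simp
    qed
  qed
qed

lemma summable_verblunsky_weighted:
  assumes "q \<noteq> 0"
  shows "summable (\<lambda>n. (cmod (verblunsky (weighted_circle_measure q) n))\<^sup>2)"
proof -
  interpret nontrivial_circle_measure_space "weighted_circle_measure q"
    by (rule nontrivial_weighted_circle_measure[OF assms])
  define N where "N = Re (circle.pinner q q)"
  have N: "N > 0"
    using Re_circle_pinner_pos[OF assms] by (simp add: N_def)
  have "summable (\<lambda>n. (cmod (\<alpha> n))\<^sup>2)"
  proof (rule summable_\<alpha>)
    \<comment> \<open>The constant is what \<open>circle_pinner_self_ge\<close> gives for
      \<open>q * f\<close> after division by the squared norm \<open>N\<close> of
      \<open>q\<close>.\<close>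
    show "(cmod (lead_coeff q))\<^sup>2 / N > 0"
      using assms N by simp
    show "(cmod (lead_coeff q))\<^sup>2 / N * (cmod (lead_coeff f))\<^sup>2 \<le> Re (pinner f f)" for f
    proof -
      have "pinner f f = circle.pinner (q * f) (q * f) / complex_of_real N"
        by (simp add: pinner_def L2_inner_weighted[OF assms] N_def)
      then have "Re (pinner f f) = Re (circle.pinner (q * f) (q * f)) / N"
        by simp
      moreover have "(cmod (lead_coeff q))\<^sup>2 * (cmod (lead_coeff f))\<^sup>2 \<le> Re (circle.pinner (q * f) (q * f))"
        using circle_pinner_self_ge[of "q * f"] by (simp only: lead_coeff_mult norm_mult power_mult_distrib)
      ultimately show ?thesis
        using N by (simp add: divide_right_mono)
    qed
  qed
  then show ?thesis
    by (simp add: verblunsky_eq)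
qed


section \<open>Homogeneous polynomials in the Hardy space\<close>

text \<open>Naming the degree lets degrees of products be added; the zero polynomial has every
  degree.\<close>

definition homogeneous_of :: "nat \<Rightarrow> complex poly poly \<Rightarrow> bool" where
  "homogeneous_of d P \<longleftrightarrow> (\<forall>i j. coeff (coeff P j) i \<noteq> 0 \<longrightarrow> i + j = d)"

lemma homogeneous_of_mult:
  assumes "homogeneous_of d P" "homogeneous_of e Q"
  shows "homogeneous_of (d + e) (P * Q)"
  unfolding homogeneous_of_def
proof (intro allI impI)
  fix i j assume "coeff (coeff (P * Q) j) i \<noteq> 0"
  then have "(\<Sum>b\<le>j. \<Sum>a\<le>i. coeff (coeff P b) a * coeff (coeff Q (j - b)) (i - a)) \<noteq> 0"
    by (simp add: coeff_mult coeff_sum)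
  then obtain b where b: "b \<le> j" "(\<Sum>a\<le>i. coeff (coeff P b) a * coeff (coeff Q (j - b)) (i - a)) \<noteq> 0"
    by (metis (no_types, lifting) atMost_iff sum.neutral)
  then obtain a where a: "a \<le> i" "coeff (coeff P b) a * coeff (coeff Q (j - b)) (i - a) \<noteq> 0"
    by (metis (no_types, lifting) atMost_iff sum.neutral)
  then have "a + b = d" "(i - a) + (j - b) = e"
    using assms by (auto simp: homogeneous_of_def)
  then show "i + j = d + e"
    using a(1) b(1) by linarith
qed

lemma homogeneous_of_smult: "homogeneous_of d P \<Longrightarrow> homogeneous_of d (smult [:c:] P)"
  by (auto simp: homogeneous_of_def)

lemma homogeneous_of_homogenize: "homogeneous_of n (homogenize n f)"
  unfolding homogeneous_of_def
proof (intro allI impI)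
  fix i j assume "coeff (coeff (homogenize n f) j) i \<noteq> 0"
  then have "(\<Sum>k\<le>n. coeff (coeff (monom (monom (coeff f k) k) (n - k)) j) i) \<noteq> 0"
    by (simp add: homogenize_def coeff_sum)
  then obtain k where "k \<le> n" "coeff (coeff (monom (monom (coeff f k) k) (n - k)) j) i \<noteq> 0"
    by (metis (no_types, lifting) atMost_iff sum.neutral)
  then show "i + j = n"
    by (auto split: if_splits)
qed

lemma homogeneous_of_zpow: "homogeneous_of k (zpow k)"
  by (auto simp: homogeneous_of_def zpow_def coeff_pCons split: nat.splits if_splits)

lemma homogeneous_of_wpow: "homogeneous_of k (wpow k)"
  by (auto simp: homogeneous_of_def wpow_def split: if_splits)

lemma dehomogenize_mult: "dehomogenize (P * Q) = dehomogenize P * dehomogenize Q"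
  by (simp add: dehomogenize_def)

lemma dehomogenize_smult: "dehomogenize (smult [:c:] P) = smult c (dehomogenize P)"
  by (simp add: dehomogenize_def)

lemma dehomogenize_homogenize: "degree f \<le> n \<Longrightarrow> dehomogenize (homogenize n f) = f"
  by (simp add: dehomogenize_def homogenize_def poly_sum poly_monom poly_as_sum_of_monoms')

lemma dehomogenize_zpow: "dehomogenize (zpow k) = monom 1 k"
  by (simp add: dehomogenize_def zpow_def)

lemma dehomogenize_wpow: "dehomogenize (wpow k) = 1"
  by (simp add: dehomogenize_def wpow_def poly_monom)

text \<open>Setting w = 1 merges no terms: in degree \<open>d\<close> the power of z determines that
  of w.\<close>

lemma coeff_dehomogenize:
  assumes "homogeneous_of d P"
  shows "coeff (dehomogenize P) i = (if i \<le> d then coeff (coeff P (d - i)) i else 0)"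
proof -
  have "coeff (dehomogenize P) i = (\<Sum>j\<le>degree P. coeff (coeff P j) i)"
    by (simp add: dehomogenize_def poly_altdef coeff_sum)
  \<comment> \<open>The range is enlarged so that it contains \<open>d - i\<close>, which may exceed
    \<open>degree P\<close>.\<close>
  also have "\<dots> = (\<Sum>j\<le>degree P + d. coeff (coeff P j) i)"
    by (rule sum.mono_neutral_left) (auto simp: coeff_eq_0)
  also have "\<dots> = (if i \<le> d then coeff (coeff P (d - i)) i else 0)"
  proof (cases "i \<le> d")
    case True
    have "(\<Sum>j\<le>degree P + d. coeff (coeff P j) i) = (\<Sum>j\<in>{d - i}. coeff (coeff P j) i)"
      using assms True by (intro sum.mono_neutral_right) (force simp: homogeneous_of_def)+
    then show ?thesis
      using True by simp
  next
    case False
    then show ?thesis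
      using assms by (force simp: homogeneous_of_def intro!: sum.neutral)
  qed
  finally show ?thesis .
qed

lemma dehomogenize_eq_0:
  assumes "homogeneous_of d P" "dehomogenize P = 0"
  shows "P = 0"
proof (intro poly_eqI)
  fix i j
  show "coeff (coeff P j) i = coeff (coeff 0 j) i"
  proof (rule ccontr)
    assume *: "coeff (coeff P j) i \<noteq> coeff (coeff 0 j) i"
    then have "i + j = d"
      using assms(1) by (simp add: homogeneous_of_def)
    then have "i \<le> d" "j = d - i"
      by auto
    then show False
      using * coeff_dehomogenize[OF assms(1), of i] assms(2) by simp
  qed
qed

lemma infsum_homogeneous:
  fixes h :: "nat \<times> nat \<Rightarrow> 'a :: {comm_monoid_add, t2_space}"
  assumes "homogeneous_of d P" "\<And>x. taylor P x = 0 \<Longrightarrow> h x = 0"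
  shows "infsum h UNIV = (\<Sum>i\<le>d. h (i, d - i))"
proof -
  have "infsum h UNIV = infsum h ((\<lambda>i. (i, d - i)) ` {..d})"
  proof (rule infsum_cong_neutral)
    fix x assume x: "x \<in> UNIV - (\<lambda>i. (i, d - i)) ` {..d}"
    obtain i j where ij: "x = (i, j)" by (cases x)
    have "i + j \<noteq> d"
    proof
      assume "i + j = d"
      then have "x = (i, d - i)" "i \<le> d"
        using ij by auto
      then show False
        using x by blast
    qed
    then have "taylor P x = 0"
      using assms(1) by (auto simp: taylor_def ij homogeneous_of_def)
    then show "h x = 0"
      by (rule assms(2))
  qed auto
  also have "\<dots> = (\<Sum>x\<in>(\<lambda>i. (i, d - i)) ` {..d}. h x)"
    by simp
  also have "\<dots> = (\<Sum>i\<le>d. h (i, d - i))"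
    by (subst sum.reindex) (auto simp: inj_on_def)
  finally show ?thesis .
qed

text \<open>Different degrees have disjoint Taylor supports; within one degree, dehomogenization
  preserves inner products by Parseval.\<close>

lemma hardy_inner_homogeneous:
  assumes "homogeneous_of d P" "homogeneous_of e Q"
  shows "hardy_inner (taylor P) (taylor Q) =
    (if d = e then circle.pinner (dehomogenize P) (dehomogenize Q) else 0)"
proof (cases "d = e")
  case True
  have deg: "degree (dehomogenize P) \<le> d" "degree (dehomogenize Q) \<le> d"
    using coeff_dehomogenize[OF assms(1)] coeff_dehomogenize[OF assms(2)] True by (auto intro!: degree_le)
  have "hardy_inner (taylor P) (taylor Q) = (\<Sum>i\<le>d. taylor P (i, d - i) * cnj (taylor Q (i, d - i)))"
    unfolding hardy_inner_def by (rule infsum_homogeneous[OF assms(1)]) simp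
  also have "\<dots> = circle.pinner (dehomogenize P) (dehomogenize Q)"
    unfolding circle_pinner_eq_sum[OF deg] using True
    by (intro sum.cong) (auto simp: taylor_def coeff_dehomogenize[OF assms(1)] coeff_dehomogenize[OF assms(2)])
  finally show ?thesis
    using True by simp
next
  case False
  have "taylor P x * cnj (taylor Q x) = 0" for x
  proof (cases x)
    case (Pair i j)
    then show ?thesis
      using assms False by (fastforce simp: taylor_def homogeneous_of_def)
  qed
  then have "hardy_inner (taylor P) (taylor Q) = 0"
    unfolding hardy_inner_def by (intro infsum_0)
  then show ?thesis
    using False by simp
qed

lemma hardy_norm_homogeneous:
  assumes "homogeneous_of d P"
  shows "(hardy_norm (taylor P))\<^sup>2 = Re (circle.pinner (dehomogenize P) (dehomogenize P))"
proof -
  have "(\<Sum>\<^sub>\<infinity>x. (cmod (taylor P x))\<^sup>2) = (\<Sum>i\<le>d. (cmod (taylor P (i, d - i)))\<^sup>2)"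
    by (rule infsum_homogeneous[OF assms]) simp
  moreover have "hardy_inner (taylor P) (taylor P) = (\<Sum>i\<le>d. taylor P (i, d - i) * cnj (taylor P (i, d - i)))"
    unfolding hardy_inner_def by (rule infsum_homogeneous[OF assms]) simp
  then have "hardy_inner (taylor P) (taylor P) = complex_of_real (\<Sum>i\<le>d. (cmod (taylor P (i, d - i)))\<^sup>2)"
    by (simp only: of_real_sum complex_norm_square)
  ultimately show ?thesis
    using hardy_inner_homogeneous[OF assms assms] by (simp add: hardy_norm_def sum_nonneg)
qed

text \<open>The two polynomials have degrees \<open>k + (d + j)\<close> and
  \<open>k + (d + n)\<close>, so only \<open>j = n\<close> survives. There dehomogenization yields
  \<open>q * reversed (\<phi> n)\<close> and \<open>q * (monom 1 k * \<phi> n)\<close> up to the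
  factor \<open>c\<close>, and \<open>c * c\<close> is exactly the normalisation of the
  measure.\<close>

lemma hardy_inner_bases:
  assumes p: "p \<noteq> 0" "homogeneous_of d p"
  shows "hardy_inner (taylor (wpow k * e_basis p j)) (taylor (zpow k * f_basis p n)) =
    (if j = n then F (poly_measure p) k n else 0)"
proof -
  define q where "q = dehomogenize p"
  have q: "q \<noteq> 0"
    using dehomogenize_eq_0[OF p(2)] p(1) by (auto simp: q_def)
  have \<mu>: "poly_measure p = weighted_circle_measure q"
    by (simp add: poly_measure_eq q_def)
  interpret nontrivial_circle_measure_space "weighted_circle_measure q"
    by (rule nontrivial_weighted_circle_measure[OF q])
  define c where "c = 1 / hardy_norm (taylor p)"
  have c: "c * c = 1 / Re (circle.pinner q q)"
    using hardy_norm_homogeneous[OF p(2)] by (simp add: c_def q_def power2_eq_square)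
  have hom: "homogeneous_of (k + (d + j)) (wpow k * e_basis p j)" "homogeneous_of (k + (d + n)) (zpow k * f_basis p n)"
    unfolding e_basis_def f_basis_def
    by (intro homogeneous_of_mult homogeneous_of_wpow homogeneous_of_zpow homogeneous_of_smult
        homogeneous_of_homogenize p(2))+
  have "dehomogenize (wpow k * e_basis p n) = smult (complex_of_real c) (q * reversed (\<phi> n))"
    using degree_reversed_le[of "\<phi> n"]
    by (simp add: e_basis_def dehomogenize_mult dehomogenize_smult dehomogenize_homogenize dehomogenize_wpow
        \<mu> c_def flip: \<phi>_def q_def)
  moreover have "dehomogenize (zpow k * f_basis p n) = smult (complex_of_real c) (q * (monom 1 k * \<phi> n))"
    by (simp add: f_basis_def dehomogenize_mult dehomogenize_smult dehomogenize_homogenize dehomogenize_zpow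
        \<mu> c_def mult_ac flip: \<phi>_def q_def)
  ultimately have "circle.pinner (dehomogenize (wpow k * e_basis p n)) (dehomogenize (zpow k * f_basis p n)) =
      complex_of_real (c * c) * circle.pinner (q * reversed (\<phi> n)) (q * (monom 1 k * \<phi> n))"
    by (simp add: circle.pinner_smult_left circle.pinner_smult_right mult.assoc)
  also have "\<dots> = pinner (reversed (\<phi> n)) (monom 1 k * \<phi> n)"
    by (simp add: c pinner_def L2_inner_weighted[OF q])
  also have "\<dots> = F (poly_measure p) k n"
    by (simp add: \<mu> F_eq pinner_def poly_mult[abs_def] poly_monom)
  finally show ?thesis
    using hardy_inner_homogeneous[OF hom] by auto
qed

text \<open>By \<open>hardy_inner_bases\<close> the double sum is supported on the diagonal.\<close>

lemma Sigma_k_eq: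
  assumes "p \<noteq> 0" "homogeneous_of d p"
  shows "Sigma_k k p = (\<Sum>\<^sub>\<infinity>n. ennreal ((cmod (F (poly_measure p) k n))\<^sup>2))"
proof -
  have "Sigma_k k p = (\<Sum>\<^sub>\<infinity>(j, n)\<in>range (\<lambda>n. (n, n)). ennreal ((cmod (F (poly_measure p) k n))\<^sup>2))"
    unfolding Sigma_k_def hardy_inner_bases[OF assms] by (rule infsum_cong_neutral) auto
  also have "\<dots> = (\<Sum>\<^sub>\<infinity>n. ennreal ((cmod (F (poly_measure p) k n))\<^sup>2))"
    by (subst infsum_reindex) (auto simp: inj_on_def o_def)
  finally show ?thesis .
qed

lemma infsum_even_odd_ennreal:
  fixes f :: "nat \<Rightarrow> ennreal"
  shows "infsum f UNIV = (\<Sum>\<^sub>\<infinity>m. f (2 * m)) + (\<Sum>\<^sub>\<infinity>m. f (2 * m + 1))"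
proof -
  have "UNIV = range (\<lambda>m::nat. 2 * m) \<union> range (\<lambda>m. 2 * m + 1)"
    by (auto simp: image_iff) presburger
  then have "infsum f UNIV = infsum f (range (\<lambda>m. 2 * m) \<union> range (\<lambda>m. 2 * m + 1))"
    by simp
  also have "\<dots> = infsum f (range (\<lambda>m. 2 * m)) + infsum f (range (\<lambda>m. 2 * m + 1))"
    by (rule infsum_Un_disjoint) (auto intro: nonneg_summable_on_complete, presburger)
  also have "\<dots> = (\<Sum>\<^sub>\<infinity>m. f (2 * m)) + (\<Sum>\<^sub>\<infinity>m. f (2 * m + 1))"
    by (simp add: infsum_reindex inj_on_def o_def)
  finally show ?thesis .
qed

section \<open>Transfer to the measure of a homogeneous polynomial\<close>

lemma nontrivial_poly_measure:
  assumes "p \<noteq> 0" "homogeneous p"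
  shows "nontrivial_circle_measure_space (poly_measure p)"
    and "summable (\<lambda>n. (cmod (verblunsky (poly_measure p) n))\<^sup>2)"
proof -
  obtain d where "homogeneous_of d p"
    using assms(2) unfolding homogeneous_def homogeneous_of_def by blast
  then have "dehomogenize p \<noteq> 0"
    using dehomogenize_eq_0 assms(1) by blast
  then show "nontrivial_circle_measure_space (poly_measure p)"
    "summable (\<lambda>n. (cmod (verblunsky (poly_measure p) n))\<^sup>2)"
    unfolding poly_measure_eq by (rule nontrivial_weighted_circle_measure summable_verblunsky_weighted)+
qed

lemma F_poly_measure:
  assumes "p \<noteq> 0" "homogeneous p"
  shows "even n \<Longrightarrow> F (poly_measure p) (Suc k) n = even_word (verblunsky (poly_measure p)) k n n"
    and "odd n \<Longrightarrow> F (poly_measure p) (Suc k) n = odd_word (verblunsky (poly_measure p)) k n n"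
proof -
  interpret nontrivial_circle_measure_space "poly_measure p"
    by (rule nontrivial_poly_measure[OF assms])
  show "even n \<Longrightarrow> F (poly_measure p) (Suc k) n = even_word (verblunsky (poly_measure p)) k n n"
    and "odd n \<Longrightarrow> F (poly_measure p) (Suc k) n = odd_word (verblunsky (poly_measure p)) k n n"
    unfolding verblunsky_eq by (rule F_even F_odd; assumption)+
qed

theorem theorem7p1:
  fixes p :: "complex poly poly" and \<mu> :: "complex measure" and \<alpha> :: "nat \<Rightarrow> complex"
  assumes "p \<noteq> 0" and "homogeneous p"
    and "\<mu> = poly_measure p" and "\<alpha> = verblunsky \<mu>"
  shows
    "(\<forall>k\<ge>1. \<forall>m.
        F \<mu> k (2 * m) = mmult (mpow (C_mat \<alpha>) (k - 1)) (L_mat \<alpha>) (2 * m) (2 * m) \<and>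
        F \<mu> k (2 * m + 1) = mmult (M_mat \<alpha>) (mpow (C_mat \<alpha>) (k - 1)) (2 * m + 1) (2 * m + 1))
     \<and> (\<forall>k\<ge>1.
        Sigma_k k p =
          (\<Sum>\<^sub>\<infinity>m. ennreal ((cmod (mmult (mpow (C_mat \<alpha>) (k - 1)) (L_mat \<alpha>) (2 * m) (2 * m)))\<^sup>2)) +
          (\<Sum>\<^sub>\<infinity>m. ennreal ((cmod (mmult (M_mat \<alpha>) (mpow (C_mat \<alpha>) (k - 1)) (2 * m + 1) (2 * m + 1)))\<^sup>2)))
     \<and> (\<forall>k\<ge>1. \<forall>n\<ge>k - 1. \<forall>p'.
        p' \<noteq> 0 \<longrightarrow> homogeneous p' \<longrightarrow>
        (\<forall>i\<in>{n + 1 - k..n + k - 1}. verblunsky (poly_measure p') i = \<alpha> i) \<longrightarrow>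
        F (poly_measure p') k n = F \<mu> k n)
     \<and> (\<forall>k\<ge>1. summable (\<lambda>n. (cmod (F \<mu> k n))\<^sup>2))"
proof -
  note \<mu> = assms(3) and \<alpha> = assms(4)
  obtain d where d: "homogeneous_of d p"
    using assms(2) unfolding homogeneous_def homogeneous_of_def by blast
  have F: "F \<mu> k (2 * m) = even_word \<alpha> (k - 1) (2 * m) (2 * m)"
    "F \<mu> k (2 * m + 1) = odd_word \<alpha> (k - 1) (2 * m + 1) (2 * m + 1)" if "k \<ge> 1" for k m
    using F_poly_measure[OF assms(1,2), of _ "k - 1"] that by (simp_all add: \<mu> \<alpha>)
  have Sigma: "Sigma_k k p = (\<Sum>\<^sub>\<infinity>m. ennreal ((cmod (even_word \<alpha> (k - 1) (2 * m) (2 * m)))\<^sup>2)) +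
      (\<Sum>\<^sub>\<infinity>m. ennreal ((cmod (odd_word \<alpha> (k - 1) (2 * m + 1) (2 * m + 1)))\<^sup>2))" if "k \<ge> 1" for k
    unfolding Sigma_k_eq[OF assms(1) d] \<mu>[symmetric] F[OF that, symmetric]
    by (rule infsum_even_odd_ennreal)
  \<comment> \<open>Both values are the same diagonal entry of a word, formed with two parameter
    sequences that agree on the window.\<close>
  have local: "F (poly_measure p') k n = F \<mu> k n"
    if "k \<ge> 1" "p' \<noteq> 0" "homogeneous p'"
      and agree: "\<forall>i\<in>{n + 1 - k..n + k - 1}. verblunsky (poly_measure p') i = \<alpha> i" for k n p'
  proof -
    \<comment> \<open>With \<open>k - 1\<close> in place of \<open>k\<close>, the window of
      \<open>word_diag_cong\<close> becomes the interval from \<open>n + 1 - k\<close> to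
      \<open>n + k - 1\<close>.\<close>
    have eq: "verblunsky (poly_measure p') l = \<alpha> l" if "n \<le> l + (k - 1)" "l \<le> n + (k - 1)" for l
      using that \<open>k \<ge> 1\<close> by (intro agree[rule_format]) auto
    show ?thesis
      using word_diag_cong[of n "k - 1", OF eq] F_poly_measure[OF that(2,3), of n "k - 1"]
        F_poly_measure[OF assms(1,2), of n "k - 1"] \<open>k \<ge> 1\<close>
      by (cases "even n") (simp_all add: \<mu> \<alpha>)
  qed
  have summable: "summable (\<lambda>n. (cmod (F \<mu> k n))\<^sup>2)" if "k \<ge> 1" for k
  proof -
    interpret nontrivial_circle_measure_space \<mu>
      unfolding \<mu> by (rule nontrivial_poly_measure[OF assms(1,2)])
    show ?thesis
      using nontrivial_poly_measure(2)[OF assms(1,2)] that by (intro summable_F) (simp_all add: verblunsky_eq flip: \<mu>)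
  qed
  show ?thesis
    unfolding even_word_def[symmetric] odd_word_def[symmetric]
    by (intro conjI allI impI; rule F Sigma local summable; assumption)
qed

end
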